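(* Let $\varepsilon\in(0,\tfrac14]$, $p\ge1$, $s\in(0,1)$ with $sp\ge1$, and $T\in\mathbb{N}$. Then the equispaced configuration $\mathbf{X}^{\mathrm{eq}}=\mathbb{Z}$ is, up to translations, the unique minimiser of $\mathcal{F}^{s,\varepsilon}_p$ in $\mathbb{X}^{4\varepsilon}_T$.
   Context: One-dimensional setting. Let $T\in\mathbb{N}$. A configuration is a set $\mathbf{X}=\bigcup_{k\in\mathbb{Z}}(\bar{\mathbf{X}}+kT)$ with $\bar{\mathbf{X}}=(x_1,\dots,x_T)\in[0,T)^T$, $x_i\le x_j$ for $i<j$. $\mathrm{d}[\mathbf{X}]$ is the minimal distance $|x_i-x_j|$ between points with distinct indices; for $l\in(0,1]$, $\mathbb{X}^l_T=\{\mathbf{X}:\mathrm{d}[\mathbf{X}]\ge l\}$. Translations: $\mathbf{X}+a=\{x+a:x\in\mathbf{X}\}$. $u[\mathbf{X}]$ is the $T$-periodic function (defined up to an additive constant) with distributional derivative $\mathcal{L}^1-\sum_{x\in\mathbf{X}}\delta_x$. Let $\rho$ be a standard (smooth, nonnegative, even, unit-mass) mollifier supported in $(-1,1)$, $\rho_\varepsilon(x)=\varepsilon^{-1}\rho(x/\varepsilon)$, $u^\varepsilon[\mathbf{X}]=u[\mathbf{X}]*\rho_\varepsilon$, and $\mathcal{F}^{s,\varepsilon}_p[\mathbf{X}]=\int_0^T\int_{\mathbb{R}}\frac{|u^\varepsilon[\mathbf{X}](x)-u^\varepsilon[\mathbf{X}](y)|^p}{|x-y|^{1+sp}}\,\mathrm{d}y\,\mathrm{d}x$.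 *)

theory Defs
  imports "HOL-Analysis.Analysis"
begin

definition min_dist :: "nat \<Rightarrow> (nat \<Rightarrow> real) \<Rightarrow> real" where
  "min_dist T x = Inf {\<bar>(x i + real_of_int k * real T) - (x j + real_of_int m * real T)\<bar> | i j k m.
      i < T \<and> j < T \<and> (i, k) \<noteq> (j, m)}"

definition config_class :: "nat \<Rightarrow> real \<Rightarrow> real set set" where
  "config_class T l = {X. \<exists>x :: nat \<Rightarrow> real.
      (\<forall>i<T. 0 \<le> x i \<and> x i < real T) \<and>
      (\<forall>i j. i \<le> j \<and> j < T \<longrightarrow> x i \<le> x j) \<and>
      X = {x i + real_of_int k * real T | i k. i < T} \<and>
      l \<le> min_dist T x}"

text \<open>The (right-continuous, normalised by u(0)=0) representative of u[X]:
  u(b) - u(a) = (b - a) - #(X \<inter> (a,b]).\<close>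
definition u_fun :: "real set \<Rightarrow> real \<Rightarrow> real" where
  "u_fun X t = (if 0 \<le> t then t - real (card (X \<inter> {0<..t}))
                else t + real (card (X \<inter> {t<..0})))"

definition mollifier :: "(real \<Rightarrow> real) \<Rightarrow> bool" where
  "mollifier \<rho> \<longleftrightarrow>
     (\<exists>f. f 0 = \<rho> \<and> (\<forall>n x. (f n has_real_derivative f (Suc n) x) (at x))) \<and>
     (\<forall>x. 0 \<le> \<rho> x) \<and> (\<forall>x. \<rho> (- x) = \<rho> x) \<and>
     closure {x. \<rho> x \<noteq> 0} \<subseteq> {-1<..<1} \<and>
     (\<rho> has_integral 1) UNIV"

definition rho_eps :: "(real \<Rightarrow> real) \<Rightarrow> real \<Rightarrow> real \<Rightarrow> real" where
  "rho_eps \<rho> \<epsilon> x = \<rho> (x / \<epsilon>) / \<epsilon>"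

definition u_eps :: "(real \<Rightarrow> real) \<Rightarrow> real \<Rightarrow> real set \<Rightarrow> real \<Rightarrow> real" where
  "u_eps \<rho> \<epsilon> X x = (LINT y|lborel. u_fun X (x - y) * rho_eps \<rho> \<epsilon> y)"

definition energy :: "(real \<Rightarrow> real) \<Rightarrow> real \<Rightarrow> real \<Rightarrow> real \<Rightarrow> nat \<Rightarrow> real set \<Rightarrow> ennreal" where
  "energy \<rho> \<epsilon> s p T X =
     (\<integral>\<^sup>+ x \<in> {0..<real T}. (\<integral>\<^sup>+ y. ennreal (\<bar>u_eps \<rho> \<epsilon> X x - u_eps \<rho> \<epsilon> X y\<bar> powr p
                                     / \<bar>x - y\<bar> powr (1 + s * p)) \<partial>lborel) \<partial>lborel)"

end

(* Substituting y = x + h, the energy is the integral over h of |h|^(-1-sp) times the slice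
   int_0^T |u(x+h) - u(x)|^p dx, and the integers minimise every slice.  If z enumerates X
   increasingly, H is the mollified Heaviside function and m is any integer, shifting indices gives
     u(x+h) - u(x) = h - m - sum_i (H(x + h - z(i+m)) - H(x - z(i))),
   a superposition of bumps of signed lengths t(i) = h + z(i) - z(i+m) with mean h - m.  By the
   separation of the points, bumps of opposite sign never meet, so the convex function
   f(v) = |h - m - v|^p - |h - m|^p satisfies f(sum of bumps) >= sum of f(bump).  The integral of
   f(bump of length t) is convex in t, and Jensen gives the lower bound.  For equispaced points and
   m the integer nearest to h the bumps are disjoint and of equal length, so the bound is attained;
   if some gap exceeds 1, Jensen is strict for m = 1 and all h slightly larger than 1. *)

theory Submission
  imports Defs
begin

section \<open>Powers of the absolute value\<close>

text \<open>The obstacle is nonlocality: for large h many steps lie between x and x + h, and a p-th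
  power does not split over them. The integer m removes it. Once the step at z(i+m) is matched with
  the step at z(i), only bumps remain, and since z advances by exactly T over T indices, their mean
  length h - m does not depend on the configuration; neither does the Jensen bound. The bound holds
  for every m, so m may be chosen for each h separately. Uniqueness needs more than an ordering of
  the slices: strictness on an interval of h passes to the energies only because the integers have
  finite energy. Near h = 0 this rests on a Lipschitz bound for the mollified u and on s < 1.
  Moreover s < 1 and sp \<ge> 1 together force p > 1.\<close>

definition apow_deriv :: "real \<Rightarrow> real \<Rightarrow> real" where
  "apow_deriv p v = p * (max v 0 powr (p - 1) - max (- v) 0 powr (p - 1))"

lemma apow_has_deriv:
  assumes p: "1 < p"
  shows "((\<lambda>v. \<bar>v\<bar> powr p) has_real_derivative apow_deriv p v) (at v)"
proof (cases "v = 0")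
  case True
  have "((\<lambda>h. \<bar>h\<bar> powr (p - 1)) \<longlongrightarrow> 0) (at (0::real))"
    by (rule tendsto_eq_intros refl | use p in force)+
  then have "((\<lambda>h. \<bar>\<bar>h\<bar> powr p / h\<bar>) \<longlongrightarrow> 0) (at (0::real))"
  proof (rule Lim_transform_eventually)
    show "\<forall>\<^sub>F h in at (0::real). \<bar>h\<bar> powr (p - 1) = \<bar>\<bar>h\<bar> powr p / h\<bar>"
      by (auto simp: eventually_at_filter abs_divide powr_diff)
  qed
  then have "((\<lambda>h. \<bar>h\<bar> powr p / h) \<longlongrightarrow> 0) (at (0::real))"
    by (rule tendsto_rabs_zero_cancel)
  then show ?thesis
    using True p by (simp add: DERIV_def apow_deriv_def)
next
  case False
  show ?thesis
  proof (cases "v > 0")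
    case True
    have "((\<lambda>v. v powr p) has_real_derivative apow_deriv p v) (at v)"
      using True p by (auto intro!: derivative_eq_intros simp: apow_deriv_def)
    then show ?thesis
      by (rule has_field_derivative_transform_within_open[of _ _ _ "{0<..}"]) (use True in auto)
  next
    case F: False
    with False have "v < 0" by simp
    then have "((\<lambda>v. (- v) powr p) has_real_derivative apow_deriv p v) (at v)"
      using p by (auto intro!: derivative_eq_intros simp: apow_deriv_def max_def)
    then show ?thesis
      by (rule has_field_derivative_transform_within_open[of _ _ _ "{..<0}"]) (use \<open>v < 0\<close> in auto)
  qed
qed

text \<open>Both powers are continuous across 0 because p > 1; this is the reason for writing p
  |v|^(p-1) sgn v through positive and negative parts.\<close>

lemma continuous_on_apow_deriv: "1 < p \<Longrightarrow> continuous_on UNIV (apow_deriv p)"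
  unfolding apow_deriv_def
  by (intro continuous_intros continuous_on_powr') auto

lemma strict_mono_apow_deriv:
  assumes "1 < p"
  shows "strict_mono (apow_deriv p)"
proof (rule strict_monoI)
  fix x y :: real
  assume xy: "x < y"
  have 1: "max x 0 powr (p - 1) \<le> max y 0 powr (p - 1)"
    and 2: "max (- y) 0 powr (p - 1) \<le> max (- x) 0 powr (p - 1)"
    using assms xy by (auto intro!: powr_mono2)
  show "apow_deriv p x < apow_deriv p y"
  proof (cases "0 < y")
    case True
    then have "max x 0 powr (p - 1) < max y 0 powr (p - 1)"
      using assms xy by (intro powr_less_mono2) auto
    with 2 assms show ?thesis by (simp add: apow_deriv_def)
  next
    case False
    then have "max (- y) 0 powr (p - 1) < max (- x) 0 powr (p - 1)"
      using assms xy by (intro powr_less_mono2) auto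
    with 1 assms show ?thesis by (simp add: apow_deriv_def)
  qed
qed

section \<open>Convexity\<close>

lemma above_tangent:
  fixes F D :: "real \<Rightarrow> real"
  assumes "\<And>x. (F has_real_derivative D x) (at x)" and "mono D"
  shows "F a + D a * (x - a) \<le> F x"
proof -
  have "convex_on UNIV F"
    by (rule convex_on_realI[OF connected_UNIV, of _ D]) (use assms in \<open>auto dest: monoD\<close>)
  from convex_on_imp_above_tangent[OF this, of a x "D a"] assms(1)[of a]
  show ?thesis by (simp add: algebra_simps)
qed

text \<open>On [0, a + b] a convex \<open>F\<close> with \<open>F 0 = 0\<close> lies below its
  chord; the chord is linear, so its values at \<open>a\<close> and \<open>b\<close> add up to
  \<open>F (a + b)\<close>.\<close>

lemma convex_superadditive_nonneg:
  fixes F :: "real \<Rightarrow> real"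
  assumes "convex_on UNIV F" "F 0 = 0" "0 \<le> a" "0 \<le> b"
  shows "F a + F b \<le> F (a + b)"
proof (cases "a + b = 0")
  case True
  then show ?thesis using assms by (simp add: add_nonneg_eq_0_iff)
next
  case False
  define s where "s = a + b"
  have s: "s > 0" using False assms s_def by simp
  have "F c \<le> c / s * F s" if "0 \<le> c" "c \<le> s" for c
    using convex_onD[OF assms(1), of "c / s" 0 s] that s assms(2) by simp
  from this[of a] this[of b] assms
  have "F a + F b \<le> (a / s + b / s) * F s" by (simp add: s_def distrib_right)
  also have "a / s + b / s = 1" using s by (simp add: s_def add_divide_distrib[symmetric])
  finally show ?thesis by (simp add: s_def)
qed

lemma convex_superadditive_sum_nonneg:
  fixes F :: "real \<Rightarrow> real"
  assumes "convex_on UNIV F" "F 0 = 0" "\<And>i. i \<in> I \<Longrightarrow> 0 \<le> v i"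
  shows "(\<Sum>i\<in>I. F (v i)) \<le> F (\<Sum>i\<in>I. v i)"
  using assms(3)
proof (induction I rule: infinite_finite_induct)
  case (insert i I)
  have "F (v i) + F (\<Sum>i\<in>I. v i) \<le> F (v i + (\<Sum>i\<in>I. v i))"
    by (intro convex_superadditive_nonneg assms(1,2) sum_nonneg insert.prems) auto
  with insert show ?case by simp
qed (use assms(2) in auto)

text \<open>Mixed signs must be excluded: v^2 at 1 and -1 already fails. Negative arguments reduce
  to positive ones by reflecting \<open>F\<close>.\<close>

lemma convex_superadditive_sum:
  fixes F :: "real \<Rightarrow> real"
  assumes "convex_on UNIV F" "F 0 = 0"
    and same_sign: "(\<forall>i\<in>I. 0 \<le> v i) \<or> (\<forall>i\<in>I. v i \<le> 0)"
  shows "(\<Sum>i\<in>I. F (v i)) \<le> F (\<Sum>i\<in>I. v i)"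
  using same_sign
proof
  assume "\<forall>i\<in>I. 0 \<le> v i"
  then show ?thesis by (intro convex_superadditive_sum_nonneg assms) auto
next
  assume neg: "\<forall>i\<in>I. v i \<le> 0"
  have "convex_on UNIV (\<lambda>x. F (- x))"
    using convex_on_linorderI[of UNIV "\<lambda>x. F (- x)"] convex_onD[OF assms(1)]
    by (metis (no_types, lifting) UNIV_I convex_UNIV minus_add_distrib scaleR_minus_right less_eq_real_def zero_less_one)
  from convex_superadditive_sum_nonneg[OF this, of I "\<lambda>i. - v i"] neg assms(2)
  show ?thesis by (simp add: sum_negf)
qed

text \<open>Jensen via the tangent at the mean \<open>c\<close>, whose linear part cancels in the
  sum. For strictness this tangent is compared with the one at 0: the latter has the smaller slope,
  so to the left of 0 it runs strictly higher.\<close>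

lemma sum_above_tangent:
  fixes F D :: "real \<Rightarrow> real" and t :: "'a \<Rightarrow> real" and c :: real
  assumes D: "\<And>x. (F has_real_derivative D x) (at x)" and mono: "mono D"
    and mean: "(\<Sum>i\<in>I. t i) = real (card I) * c" and fin: "finite I"
  shows "real (card I) * F c \<le> (\<Sum>i\<in>I. F (t i))"
    and "\<lbrakk>j \<in> I; t j < 0; D 0 < D c; 0 < c\<rbrakk> \<Longrightarrow> real (card I) * F c < (\<Sum>i\<in>I. F (t i))"
proof -
  note tan = above_tangent[OF D mono]
  have eq: "(\<Sum>i\<in>I. F c + D c * (t i - c)) = real (card I) * F c"
    using mean by (simp add: sum.distrib sum_distrib_left[symmetric] sum_subtractf)
  show "real (card I) * F c \<le> (\<Sum>i\<in>I. F (t i))"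
    unfolding eq[symmetric] by (intro sum_mono tan)
  assume j: "j \<in> I" "t j < 0" "D 0 < D c" "0 < c"
  have "F c + D c * (t j - c) \<le> F 0 + D c * t j"
    using tan[of c 0] by (simp add: algebra_simps)
  also have "\<dots> < F 0 + D 0 * t j" using j by simp
  also have "\<dots> \<le> F (t j)" using tan[of 0 "t j"] by simp
  finally have "F c + D c * (t j - c) < F (t j)" .
  then show "real (card I) * F c < (\<Sum>i\<in>I. F (t i))"
    unfolding eq[symmetric] using j fin by (intro sum_strict_mono_ex1 ballI tan) auto
qed

section \<open>Smoothed steps and the bump functional\<close>

text \<open>An abstract transition from 0 to 1 with density \<open>r\<close>; the calculus of a
  single bump uses nothing else about the mollifier.\<close>

locale smoothed_step =
  fixes H r :: "real \<Rightarrow> real" and \<epsilon> :: real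
  assumes eps_pos: "0 < \<epsilon>"
    and H_deriv: "\<And>x. (H has_real_derivative r x) (at x)"
    and r_cont: "continuous_on UNIV r"
    and r_nonneg: "\<And>x. 0 \<le> r x"
    and r_zero: "\<And>x. \<epsilon> \<le> \<bar>x\<bar> \<Longrightarrow> r x = 0"
    and H_left: "\<And>x. x \<le> - \<epsilon> \<Longrightarrow> H x = 0"
    and H_right: "\<And>x. \<epsilon> \<le> x \<Longrightarrow> H x = 1"
begin

lemma H_mono: "x \<le> y \<Longrightarrow> H x \<le> H y"
  by (rule DERIV_nonneg_imp_nondecreasing) (use H_deriv r_nonneg in blast)+

lemma H_bounds: "0 \<le> H x" "H x \<le> 1"
proof -
  show "0 \<le> H x" using H_mono[of "min x (- \<epsilon>)" x] H_left[of "min x (- \<epsilon>)"] by simp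
  show "H x \<le> 1" using H_mono[of x "max x \<epsilon>"] H_right[of "max x \<epsilon>"] by simp
qed

lemma H_posD: "0 < H x \<Longrightarrow> - \<epsilon> < x"
  by (rule ccontr) (simp add: H_left)

lemma H_less_1D: "H x < 1 \<Longrightarrow> x < \<epsilon>"
  by (rule ccontr) (simp add: H_right)

lemma H_cont: "continuous_on A H"
  using H_deriv by (meson DERIV_isCont continuous_at_imp_continuous_on)

lemma H_cont_compose [continuous_intros]: "continuous_on A g \<Longrightarrow> continuous_on A (\<lambda>x. H (g x))"
  by (rule continuous_on_compose2[OF H_cont[of UNIV]]) auto

lemma r_cont_compose [continuous_intros]: "continuous_on A g \<Longrightarrow> continuous_on A (\<lambda>x. r (g x))"
  by (rule continuous_on_compose2[OF r_cont]) auto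

text \<open>Since \<open>H\<close> climbs from 0 to 1, its density is positive at some
  \<open>y\<close>. There \<open>H\<close> drops strictly just to the left, and monotonicity carries
  the drop to every \<open>t > 0\<close>.\<close>

lemma step_strict:
  obtains y where "\<bar>y\<bar> < \<epsilon>" "0 < r y" "\<And>t. 0 < t \<Longrightarrow> H (y - t) < H y"
proof -
  have "\<exists>y. r y \<noteq> 0"
  proof (rule ccontr)
    assume "\<not> ?thesis"
    then have "H (- \<epsilon>) = H \<epsilon>" using H_deriv by (intro DERIV_isconst_all) metis
    then show False using H_left[of "- \<epsilon>"] H_right[of \<epsilon>] by simp
  qed
  then obtain y where y: "0 < r y" using r_nonneg by (metis less_eq_real_def)
  then have "\<bar>y\<bar> < \<epsilon>" using r_zero[of y] by force
  from DERIV_pos_inc_left[OF H_deriv y] obtain d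
    where d: "d > 0" "\<And>h. 0 < h \<Longrightarrow> h < d \<Longrightarrow> H (y - h) < H y" by blast
  have "H (y - t) < H y" if "0 < t" for t
  proof -
    have "H (y - t) \<le> H (y - min t (d / 2))" by (rule H_mono) simp
    also have "\<dots> < H y" using d that by simp
    finally show ?thesis .
  qed
  with y \<open>\<bar>y\<bar> < \<epsilon>\<close> that show ?thesis by blast
qed

definition bump :: "(real \<Rightarrow> real) \<Rightarrow> real \<Rightarrow> real" where
  "bump f t = integral UNIV (\<lambda>x. f (H (x + t) - H x))"

text \<open>After the substitution \<open>y = x + t\<close> the derivative of \<open>bump f\<close> is an integral against the fixed
  density \<open>r\<close>, whose integrand is visibly increasing in \<open>t\<close>; this is why \<open>bump f\<close> is convex.\<close>

definition bump_deriv :: "(real \<Rightarrow> real) \<Rightarrow> real \<Rightarrow> real" where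
  "bump_deriv f' t = integral {- \<epsilon>..\<epsilon>} (\<lambda>y. f' (H y - H (y - t)) * r y)"

lemma step_diff_zero:
  assumes "x \<notin> {min (- t) 0 - \<epsilon><..<max (- t) 0 + \<epsilon>}"
  shows "H (x + t) - H x = 0"
  using assms H_left[of x] H_left[of "x + t"] H_right[of x] H_right[of "x + t"]
  by (auto simp: min_def max_def not_less split: if_splits)

text \<open>With \<open>f 0 = 0\<close> the integrand is supported in a bounded interval. The
  freedom in \<open>a\<close> and \<open>b\<close> lets one interval serve for all nearby
  \<open>t\<close>, as differentiation under the integral requires.\<close>

lemma bump_eq:
  assumes f: "continuous_on UNIV f" "f 0 = 0"
    and a: "a \<le> - \<epsilon> - \<bar>t\<bar>" and b: "\<epsilon> + \<bar>t\<bar> \<le> b"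
  shows "bump f t = integral {a..b} (\<lambda>x. f (H (x + t) - H x))"
proof -
  let ?g = "\<lambda>x. f (H (x + t) - H x)"
  have "?g integrable_on {a..b}"
    by (intro integrable_continuous_real continuous_on_compose2[OF f(1)] continuous_intros) auto
  then have "(?g has_integral integral {a..b} ?g) UNIV"
  proof (rule has_integral_on_superset[OF integrable_integral])
    fix x assume "x \<notin> {a..b}"
    then have "x \<notin> {min (- t) 0 - \<epsilon><..<max (- t) 0 + \<epsilon>}" using a b eps_pos by (auto simp: min_def max_def)
    then show "?g x = 0" using step_diff_zero[of x t] f(2) by simp
  qed auto
  then show ?thesis unfolding bump_def by (rule integral_unique)
qed

lemma bump_has_deriv:
  assumes f: "\<And>v. (f has_real_derivative f' v) (at v)" "continuous_on UNIV f'" "f 0 = 0"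
  shows "(bump f has_real_derivative bump_deriv f' t) (at t)"
proof -
  \<comment> \<open>Large enough for every length within distance 1 of \<open>t\<close>.\<close>
  define R where "R = \<bar>t\<bar> + 1 + \<epsilon>"
  define U where "U = ball t 1"
  have fc: "continuous_on UNIV f"
    using f(1) by (meson DERIV_isCont continuous_at_imp_continuous_on)
  note cf = continuous_on_compose2[OF fc] and cf' = continuous_on_compose2[OF f(2)]
  let ?g = "\<lambda>t x. f (H (x + t) - H x)" and ?g' = "\<lambda>t x. f' (H (x + t) - H x) * r (x + t)"
  have "((\<lambda>t. integral (cbox (- R) R) (?g t)) has_field_derivative integral (cbox (- R) R) (?g' t)) (at t within U)"
  proof (rule leibniz_rule_field_derivative)
    fix s x
    show "((\<lambda>s. ?g s x) has_field_derivative ?g' s x) (at s within U)"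
      by (rule has_field_derivative_at_within)
         (rule DERIV_chain2[OF f(1)], auto intro!: derivative_eq_intros DERIV_chain2[OF H_deriv])
  next
    show "?g s integrable_on cbox (- R) R" for s
      by (intro integrable_continuous cf continuous_intros) auto
    show "continuous_on (U \<times> cbox (- R) R) (\<lambda>(t, x). ?g' t x)"
      unfolding case_prod_unfold by (intro continuous_intros cf') auto
  qed (auto simp: U_def)
  then have "((\<lambda>t. integral {- R..R} (?g t)) has_field_derivative integral {- R..R} (?g' t)) (at t)"
    by (simp add: U_def at_within_open[of t "ball t 1"])
  then have "(bump f has_field_derivative integral {- R..R} (?g' t)) (at t)"
  proof (rule has_field_derivative_transform_within_open[of _ _ _ U])
    fix s assume "s \<in> U"
    then have "\<bar>s\<bar> \<le> \<bar>t\<bar> + 1" by (auto simp: U_def dist_real_def)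
    then show "integral {- R..R} (?g s) = bump f s"
      by (intro bump_eq[symmetric] fc f(3)) (auto simp: R_def)
  qed (auto simp: U_def)
  \<comment> \<open>Translating by \<open>t\<close> moves the dependence on \<open>t\<close> from
    the density into \<open>f'\<close>; the new range still contains the support of
    \<open>r\<close>.\<close>
  moreover have "integral {- R..R} (?g' t) = bump_deriv f' t"
  proof -
    let ?k = "\<lambda>y. f' (H y - H (y - t)) * r y"
    have kc: "continuous_on A ?k" for A by (intro continuous_intros cf') auto
    have "integral {- R..R} (?g' t) = integral {- R..R} (?k \<circ> (\<lambda>x. x + t))"
      by (simp add: o_def)
    also have "\<dots> = integral {- R + t..R + t} ?k" by (rule integral_shift[OF kc])
    also have "\<dots> = integral {- \<epsilon>..\<epsilon>} ?k"
    proof (rule integral_unique, rule has_integral_on_superset)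
      show "(?k has_integral integral {- \<epsilon>..\<epsilon>} ?k) {- \<epsilon>..\<epsilon>}"
        by (intro integrable_integral integrable_continuous_real kc)
    qed (use r_zero in \<open>auto simp: R_def\<close>)
    finally show ?thesis by (simp add: bump_deriv_def)
  qed
  ultimately show ?thesis by simp
qed

lemma bump_deriv_mono:
  assumes "continuous_on UNIV f'" "mono f'"
  shows "mono (bump_deriv f')"
proof (rule monoI)
  fix s t :: real
  assume "s \<le> t"
  then show "bump_deriv f' s \<le> bump_deriv f' t"
    unfolding bump_deriv_def
    by (intro integral_le integrable_continuous_real continuous_intros continuous_on_compose2[OF assms(1)]
         mult_right_mono r_nonneg monoD[OF assms(2)] diff_left_mono H_mono) auto
qed

text \<open>The difference of the two derivatives is the integral of a continuous nonnegative
  function, which is positive where \<open>r\<close> is positive and \<open>H\<close> has strictly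
  risen over length \<open>t\<close>.\<close>

lemma bump_deriv_strict:
  assumes f': "continuous_on UNIV f'" "strict_mono f'" and t: "0 < t"
  shows "bump_deriv f' 0 < bump_deriv f' t"
proof -
  have mono: "mono f'" using f'(2) by (rule strict_mono_mono)
  let ?k = "\<lambda>y. (f' (H y - H (y - t)) - f' 0) * r y"
  have kc: "continuous_on {- \<epsilon>..\<epsilon>} ?k"
    by (intro continuous_intros continuous_on_compose2[OF f'(1)]) auto
  have k0: "0 \<le> ?k y" for y
    using t by (intro mult_nonneg_nonneg r_nonneg) (auto intro!: monoD[OF mono] H_mono)
  have eq: "bump_deriv f' t - bump_deriv f' 0 = integral {- \<epsilon>..\<epsilon>} ?k"
    unfolding bump_deriv_def
    by (subst Henstock_Kurzweil_Integration.integral_diff[symmetric])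
       (auto intro!: integrable_continuous_real continuous_intros continuous_on_compose2[OF f'(1)] simp: left_diff_distrib)
  have "integral {- \<epsilon>..\<epsilon>} ?k \<noteq> 0"
  proof
    assume "integral {- \<epsilon>..\<epsilon>} ?k = 0"
    then have "\<forall>y\<in>{- \<epsilon>..\<epsilon>}. ?k y = 0"
      using integral_eq_0_iff[OF kc, of] k0 eps_pos by simp
    moreover obtain y where y: "\<bar>y\<bar> < \<epsilon>" "0 < r y" "H (y - t) < H y"
      using step_strict t by metis
    ultimately have "f' (H y - H (y - t)) = f' 0" by force
    then show False using y strict_monoD[OF f'(2), of 0 "H y - H (y - t)"] by simp
  qed
  moreover have "0 \<le> integral {- \<epsilon>..\<epsilon>} ?k"
    by (intro integral_nonneg integrable_continuous_real kc k0)
  ultimately show ?thesis using eq by linarith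
qed

end

section \<open>The mollified step\<close>

text \<open>The mollified Heaviside function: \<open>indicator {..x} y\<close> is the Heaviside
  function at x - y, the form in which each point enters the convolution
  \<open>u_eps\<close>.\<close>

definition step_eps :: "(real \<Rightarrow> real) \<Rightarrow> real \<Rightarrow> real \<Rightarrow> real" where
  "step_eps \<rho> \<epsilon> x = (LINT y|lborel. indicator {..x} y * rho_eps \<rho> \<epsilon> y)"

lemma integrable_compact_support:
  fixes f :: "real \<Rightarrow> real"
  assumes "continuous_on UNIV f" "\<And>x. c < \<bar>x\<bar> \<Longrightarrow> f x = 0"
  shows "integrable lborel f"
proof -
  have "integrable lborel (\<lambda>x. f x * indicator {- c..c} x)"
    using assms(1) by (intro borel_integrable_atLeastAtMost) (simp add: continuous_on_eq_continuous_at)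
  also have "(\<lambda>x. f x * indicator {- c..c} x) = f"
    using assms(2) by (force simp: fun_eq_iff indicator_def)
  finally show ?thesis .
qed

context
  fixes \<rho> :: "real \<Rightarrow> real" and \<epsilon> :: real
  assumes moll: "mollifier \<rho>" and eps: "0 < \<epsilon>"
begin

lemma mollifier_cont: "continuous_on UNIV \<rho>"
  using moll unfolding mollifier_def
  by (metis DERIV_isCont continuous_at_imp_continuous_on)

lemma mollifier_support: "1 \<le> \<bar>x\<bar> \<Longrightarrow> \<rho> x = 0"
  using moll closure_subset[of "{x. \<rho> x \<noteq> 0}"] unfolding mollifier_def by force

lemma rho_eps_cont: "continuous_on A (rho_eps \<rho> \<epsilon>)"
  unfolding rho_eps_def[abs_def] using eps
  by (intro continuous_intros continuous_on_compose2[OF mollifier_cont]) auto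

lemma rho_eps_nonneg: "0 \<le> rho_eps \<rho> \<epsilon> x"
  using moll eps by (simp add: mollifier_def rho_eps_def)

lemma rho_eps_support: "\<epsilon> \<le> \<bar>x\<bar> \<Longrightarrow> rho_eps \<rho> \<epsilon> x = 0"
  using mollifier_support[of "x / \<epsilon>"] eps by (simp add: rho_eps_def)

lemma integrable_mult_rho_eps:
  assumes "continuous_on UNIV f"
  shows "integrable lborel (\<lambda>y. f y * rho_eps \<rho> \<epsilon> y)"
  by (rule integrable_compact_support[of _ \<epsilon>])
     (use rho_eps_support assms rho_eps_cont in \<open>auto intro!: continuous_intros\<close>)

lemma integrable_rho_eps: "integrable lborel (rho_eps \<rho> \<epsilon>)"
  using integrable_mult_rho_eps[of "\<lambda>_. 1"] by simp

lemma integral_rho_eps: "(LINT y|lborel. rho_eps \<rho> \<epsilon> y) = 1"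
proof -
  have "integrable lborel \<rho>"
    by (rule integrable_compact_support[of _ 1]) (use mollifier_support mollifier_cont in auto)
  then have "(LINT y|lborel. \<rho> y) = 1"
    using has_integral_integral_real moll unfolding mollifier_def by (metis has_integral_unique)
  then show ?thesis
    using lborel_integral_real_affine[of "1 / \<epsilon>" \<rho> 0] eps by (simp add: rho_eps_def[abs_def] abs_of_pos)
qed

lemma integrable_indicator_rho_eps:
  assumes "A \<in> sets borel"
  shows "integrable lborel (\<lambda>y. indicator A y * rho_eps \<rho> \<epsilon> y)"
  using integrable_mult_indicator[OF _ integrable_rho_eps, of A] assms by simp

text \<open>Cutting the half-line to the left of the support leaves a compact interval, to which the
  fundamental theorem of calculus applies.\<close>

lemma step_eps_eq:
  assumes "a \<le> - \<epsilon>"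
  shows "step_eps \<rho> \<epsilon> x = integral {a..x} (rho_eps \<rho> \<epsilon>)"
proof -
  have "step_eps \<rho> \<epsilon> x = (LINT y|lborel. indicator {a..x} y * rho_eps \<rho> \<epsilon> y)"
    unfolding step_eps_def
    by (intro Bochner_Integration.integral_cong)
       (use rho_eps_support assms in \<open>auto simp: indicator_def\<close>)
  also have "\<dots> = integral UNIV (\<lambda>y. indicator {a..x} y * rho_eps \<rho> \<epsilon> y)"
    using has_integral_integral_real[OF integrable_indicator_rho_eps[of "{a..x}"]]
    by (simp add: integral_unique)
  also have "\<dots> = integral {a..x} (rho_eps \<rho> \<epsilon>)"
    by (subst integral_restrict_UNIV[symmetric])
       (auto intro!: integral_cong simp: indicator_def)
  finally show ?thesis .
qed

lemma smoothed_step_eps: "smoothed_step (step_eps \<rho> \<epsilon>) (rho_eps \<rho> \<epsilon>) \<epsilon>"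
proof
  fix x :: real
  define a where "a = - \<epsilon> - \<bar>x\<bar> - 1"
  have x: "x \<in> {a<..<\<bar>x\<bar> + 1}" using eps by (auto simp: a_def)
  have "((\<lambda>x. integral {a..x} (rho_eps \<rho> \<epsilon>)) has_real_derivative rho_eps \<rho> \<epsilon> x) (at x within {a..\<bar>x\<bar> + 1})"
    using x by (intro integral_has_real_derivative rho_eps_cont) auto
  then have "((\<lambda>x. integral {a..x} (rho_eps \<rho> \<epsilon>)) has_real_derivative rho_eps \<rho> \<epsilon> x) (at x within {a<..<\<bar>x\<bar> + 1})"
    by (rule DERIV_subset) auto
  then have "((\<lambda>x. integral {a..x} (rho_eps \<rho> \<epsilon>)) has_real_derivative rho_eps \<rho> \<epsilon> x) (at x)"
    using x by (subst (asm) at_within_open) auto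
  moreover have "step_eps \<rho> \<epsilon> = (\<lambda>x. integral {a..x} (rho_eps \<rho> \<epsilon>))"
    by (rule ext, rule step_eps_eq) (simp add: a_def)
  ultimately show "(step_eps \<rho> \<epsilon> has_real_derivative rho_eps \<rho> \<epsilon> x) (at x)" by simp
next
  fix x assume "x \<le> - \<epsilon>"
  then have "(\<lambda>y. indicator {..x} y * rho_eps \<rho> \<epsilon> y) = (\<lambda>_. 0)"
    using rho_eps_support by (auto simp: indicator_def)
  then show "step_eps \<rho> \<epsilon> x = 0" by (simp add: step_eps_def)
next
  fix x assume "\<epsilon> \<le> x"
  then have "(\<lambda>y. indicator {..x} y * rho_eps \<rho> \<epsilon> y) = rho_eps \<rho> \<epsilon>"
    using rho_eps_support by (force simp: indicator_def)
  then show "step_eps \<rho> \<epsilon> x = 1" by (simp add: step_eps_def integral_rho_eps)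
qed (use eps rho_eps_cont rho_eps_nonneg rho_eps_support in auto)

end

section \<open>Periodic point sequences\<close>

text \<open>Enumerating the configuration by all integers turns neighbours, periods and the shift by
  m into index arithmetic without wrap-around.\<close>

locale periodic_points =
  fixes z :: "int \<Rightarrow> real" and T :: nat and l :: real
  assumes T_pos: "1 \<le> T" and l_pos: "0 < l"
    and period: "z (i + int T) = z i + real T"
    and gap: "z i + l \<le> z (i + 1)"
begin

lemma spaced: "i \<le> j \<Longrightarrow> z i + l * of_int (j - i) \<le> z j"
proof (induction j rule: int_ge_induct)
  case (step j)
  then show ?case using gap[of j] by (simp add: algebra_simps)
qed simp

lemma spaced_less: "i < j \<Longrightarrow> z i + l \<le> z j"
proof -
  assume "i < j"
  then have "l * 1 \<le> l * of_int (j - i)" using l_pos by (intro mult_left_mono) auto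
  then show ?thesis using spaced[of i j] \<open>i < j\<close> by simp
qed

lemma z_mono: "i \<le> j \<Longrightarrow> z i \<le> z j"
  using spaced_less[of i j] l_pos by (cases "i = j") auto

lemma z_inj: "inj z"
  by (rule injI) (metis l_pos less_add_same_cancel1 linorder_neqE_linordered_idom not_less spaced_less)

lemma period_mult: "z (i + k * int T) = z i + of_int k * real T"
proof (induction k rule: int_induct[where k = 0])
  case (step1 k)
  then show ?case using period[of "i + k * int T"] by (simp add: algebra_simps)
next
  case (step2 k)
  then show ?case using period[of "i + (k - 1) * int T"] by (simp add: algebra_simps)
qed simp

lemma z_lower: "0 \<le> n \<Longrightarrow> z 0 + l * of_int n \<le> z n"
  using spaced[of 0 n] by simp

lemma z_upper: "0 \<le> n \<Longrightarrow> z (- n) \<le> z 0 - l * of_int n"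
  using spaced[of "- n" 0] by simp

text \<open>The gaps force linear growth of \<open>z\<close>, so every sum over the points that
  matter on a bounded interval is finite.\<close>

lemma window:
  obtains N :: int where "0 < N" "\<And>i. N \<le> i \<Longrightarrow> L < z i" "\<And>i. i \<le> - N \<Longrightarrow> z i < - L"
proof -
  define N where "N = \<lceil>(\<bar>L\<bar> + \<bar>z 0\<bar> + 1) / l\<rceil>"
  have N: "\<bar>L\<bar> + \<bar>z 0\<bar> + 1 \<le> l * of_int N"
    using l_pos le_of_int_ceiling[of "(\<bar>L\<bar> + \<bar>z 0\<bar> + 1) / l"]
    unfolding N_def by (simp only: pos_divide_le_eq mult.commute[of l])
  have "0 < N" using l_pos by (simp add: N_def add_nonneg_pos)
  moreover have "L < z i" if "N \<le> i" for i
    using z_lower[of N] z_mono[OF that] N \<open>0 < N\<close> by linarith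
  moreover have "z i < - L" if "i \<le> - N" for i
    using z_upper[of N] z_mono[OF that] N \<open>0 < N\<close> by linarith
  ultimately show ?thesis using that by blast
qed

text \<open>The difference of indicators counts points with sign and so merges the two cases of
  \<open>u_fun\<close>. Its second half is constant in \<open>t\<close> and drops out of
  increments.\<close>

lemma u_fun_eq:
  assumes W: "finite W" "\<And>i. \<bar>z i\<bar> \<le> L \<Longrightarrow> i \<in> W" and t: "\<bar>t\<bar> \<le> L"
  shows "u_fun (range z) t = t - (\<Sum>i\<in>W. of_bool (z i \<le> t) - of_bool (z i \<le> 0))"
proof -
  have card: "real (card (range z \<inter> {a<..b})) = (\<Sum>i\<in>W. of_bool (a < z i \<and> z i \<le> b))"
    if "- L \<le> a" "b \<le> L" for a b
  proof -
    have "range z \<inter> {a<..b} = z ` {i\<in>W. a < z i \<and> z i \<le> b}"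
      using W(2) that by force
    then have "card (range z \<inter> {a<..b}) = card {i\<in>W. a < z i \<and> z i \<le> b}"
      using z_inj by (simp add: card_image inj_on_subset)
    also have "real \<dots> = (\<Sum>i\<in>W. of_bool (a < z i \<and> z i \<le> b))"
      using W(1) by (simp add: of_bool_def sum.If_cases Int_def)
    finally show ?thesis .
  qed
  show ?thesis
  proof (cases "0 \<le> t")
    case True
    then have "u_fun (range z) t = t - (\<Sum>i\<in>W. of_bool (0 < z i \<and> z i \<le> t))"
      using card[of 0 t] t by (simp add: u_fun_def)
    also have "(\<Sum>i\<in>W. of_bool (0 < z i \<and> z i \<le> t) :: real) = (\<Sum>i\<in>W. of_bool (z i \<le> t) - of_bool (z i \<le> 0))"
      using True by (intro sum.cong) auto
    finally show ?thesis by simp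
  next
    case False
    then have "u_fun (range z) t = t - (\<Sum>i\<in>W. - of_bool (t < z i \<and> z i \<le> 0))"
      using card[of t 0] t by (simp add: u_fun_def sum_negf)
    also have "(\<Sum>i\<in>W. - of_bool (t < z i \<and> z i \<le> 0) :: real) = (\<Sum>i\<in>W. of_bool (z i \<le> t) - of_bool (z i \<le> 0))"
      using False by (intro sum.cong) auto
    finally show ?thesis by simp
  qed
qed

text \<open>Termwise convolution: each jump becomes a smoothed step. The first moment of the kernel
  is kept as a constant, since it cancels in increments. Only |y| < \<epsilon> contributes, and
  there x - y stays within the window.\<close>

lemma u_eps_eq:
  assumes moll: "mollifier \<rho>" and eps: "0 < \<epsilon>"
    and W: "finite W" "\<And>i. \<bar>z i\<bar> \<le> L \<Longrightarrow> i \<in> W" and x: "\<bar>x\<bar> + \<epsilon> \<le> L"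
  shows "u_eps \<rho> \<epsilon> (range z) x =
    x - (LINT y|lborel. y * rho_eps \<rho> \<epsilon> y) - (\<Sum>i\<in>W. step_eps \<rho> \<epsilon> (x - z i) - of_bool (z i \<le> 0))"
proof -
  let ?g = "rho_eps \<rho> \<epsilon>"
  note int = integrable_indicator_rho_eps[OF moll eps] integrable_rho_eps[OF moll eps]
    integrable_mult_rho_eps[OF moll eps]
  have "u_fun (range z) (x - y) * ?g y = (x * ?g y - y * ?g y)
      - (\<Sum>i\<in>W. indicator {..x - z i} y * ?g y - of_bool (z i \<le> 0) * ?g y)" for y
  proof (cases "\<bar>y\<bar> < \<epsilon>")
    case True
    then have "\<bar>x - y\<bar> \<le> L" using x by linarith
    then have "u_fun (range z) (x - y) = x - y - (\<Sum>i\<in>W. of_bool (z i \<le> x - y) - of_bool (z i \<le> 0))"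
      by (intro u_fun_eq W)
    moreover have "of_bool (z i \<le> x - y) = (indicator {..x - z i} y :: real)" for i
      by (auto simp: indicator_def)
    ultimately show ?thesis
      by (simp only: left_diff_distrib sum_distrib_right)
  next
    case False
    then have "?g y = 0" using rho_eps_support[OF moll eps] by simp
    then show ?thesis by simp
  qed
  then have "u_eps \<rho> \<epsilon> (range z) x = (LINT y|lborel. (x * ?g y - y * ?g y)
      - (\<Sum>i\<in>W. indicator {..x - z i} y * ?g y - of_bool (z i \<le> 0) * ?g y))"
    by (simp add: u_eps_def)
  also have "\<dots> = x - (LINT y|lborel. y * ?g y) - (\<Sum>i\<in>W. step_eps \<rho> \<epsilon> (x - z i) - of_bool (z i \<le> 0))"
    using int(3)[of "\<lambda>y. y"]
    by (subst Bochner_Integration.integral_diff Bochner_Integration.integral_sum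
         | simp add: int Bochner_Integration.integrable_diff Bochner_Integration.integrable_sum integral_rho_eps[OF moll eps] step_eps_def)+
  finally show ?thesis .
qed

lemma u_eps_cont:
  assumes moll: "mollifier \<rho>" and eps: "0 < \<epsilon>"
  shows "continuous_on UNIV (u_eps \<rho> \<epsilon> (range z))"
proof (rule continuous_at_imp_continuous_on, rule ballI)
  fix x :: real
  interpret smoothed_step "step_eps \<rho> \<epsilon>" "rho_eps \<rho> \<epsilon>" \<epsilon> by (rule smoothed_step_eps[OF moll eps])
  define L where "L = \<bar>x\<bar> + 1 + \<epsilon>"
  obtain N where N: "0 < N" "\<And>i. N \<le> i \<Longrightarrow> L < z i" "\<And>i. i \<le> - N \<Longrightarrow> z i < - L"
    using window by blast
  have W: "i \<in> {- N..<N}" if "\<bar>z i\<bar> \<le> L" for i using N(2,3)[of i] that by force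
  let ?v = "\<lambda>x. x - (LINT y|lborel. y * rho_eps \<rho> \<epsilon> y) - (\<Sum>i\<in>{- N..<N}. step_eps \<rho> \<epsilon> (x - z i) - of_bool (z i \<le> 0))"
  have "isCont (u_eps \<rho> \<epsilon> (range z)) x \<longleftrightarrow> isCont ?v x"
  proof (rule isCont_cong)
    have "\<forall>\<^sub>F y in nhds x. y \<in> ball x 1" by (rule eventually_nhds_in_open) auto
    then show "\<forall>\<^sub>F y in nhds x. u_eps \<rho> \<epsilon> (range z) y = ?v y"
      by eventually_elim (rule u_eps_eq[OF moll eps _ W], auto simp: L_def dist_real_def)
  qed
  moreover have "continuous_on UNIV ?v" by (intro continuous_intros)
  ultimately show "isCont (u_eps \<rho> \<epsilon> (range z)) x" by (simp add: continuous_on_eq_continuous_at)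
qed

end

section \<open>Sums over integer windows\<close>

lemma sum_int_telescope:
  fixes c :: "int \<Rightarrow> real"
  assumes "a \<le> b"
  shows "(\<Sum>i\<in>{a..<b}. c (i + 1) - c i) = c b - c a"
  using assms
proof (induction b rule: int_ge_induct)
  case (step b)
  have "{a..<b + 1} = insert b {a..<b}" using step by auto
  then show ?case using step by simp
qed simp

text \<open>A shift by one telescopes; shifting the window by \<open>m\<close> therefore leaves only
  terms at its two ends.\<close>

lemma sum_int_shift:
  fixes c :: "int \<Rightarrow> real"
  assumes "0 \<le> m" "a \<le> b"
  shows "(\<Sum>i\<in>{a..<b}. c (i + m) - c i) = (\<Sum>j\<in>{0..<m}. c (b + j) - c (a + j))"
  using assms(1)
proof (induction m rule: int_ge_induct)
  case (step m)
  have "(\<Sum>i\<in>{a..<b}. c (i + (m + 1)) - c i)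
      = (\<Sum>i\<in>{a..<b}. (c (i + 1 + m) - c (i + m)) + (c (i + m) - c i))"
    by (simp add: ac_simps)
  also have "\<dots> = (c (b + m) - c (a + m)) + (\<Sum>i\<in>{a..<b}. c (i + m) - c i)"
    using sum_int_telescope[OF assms(2), of "\<lambda>i. c (i + m)"] by (simp only: sum.distrib)
  also have "\<dots> = (\<Sum>j\<in>insert m {0..<m}. c (b + j) - c (a + j))" using step by simp
  also have "insert m {0..<m} = {0..<m + 1}" using step by auto
  finally show ?case .
qed simp

text \<open>The hypothesis concerns only indices near the two ends. It is applied to the smoothed
  steps, where \<open>d\<close> is -1, and to the points themselves, where \<open>d\<close> is the
  period. A negative shift is a positive one read backwards.\<close>

lemma sum_int_shift_const:
  fixes c :: "int \<Rightarrow> real"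
  assumes "a \<le> b"
    and d: "\<And>i j. \<bar>i - a\<bar> \<le> \<bar>m\<bar> \<Longrightarrow> \<bar>j - b\<bar> \<le> \<bar>m\<bar> \<Longrightarrow> j - i = b - a \<Longrightarrow> c j - c i = d"
  shows "(\<Sum>i\<in>{a..<b}. c (i + m) - c i) = of_int m * d"
proof (cases "0 \<le> m")
  case True
  have "(\<Sum>i\<in>{a..<b}. c (i + m) - c i) = (\<Sum>j\<in>{0..<m}. d)"
    unfolding sum_int_shift[OF True assms(1)] by (rule sum.cong) (auto intro!: d)
  then show ?thesis using True by simp
next
  case False
  have "(\<Sum>i\<in>{a..<b}. c (i + m) - c i) = - (\<Sum>i\<in>{a..<b}. c (i + - m + m) - c (i + m))"
    by (simp add: sum_negf[symmetric])
  also have "\<dots> = - (\<Sum>j\<in>{0..<- m}. c (b + j + m) - c (a + j + m))"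
    using False by (subst sum_int_shift[OF _ assms(1), of "- m" "\<lambda>i. c (i + m)"]) auto
  also have "\<dots> = - (\<Sum>j\<in>{0..<- m}. d)"
    by (intro arg_cong[where f = uminus] sum.cong d) auto
  finally show ?thesis using False by simp
qed

text \<open>Moving the index by a period is translating the argument by T, so for each residue the n
  blocks of indices fill n adjacent intervals: an exact finite form of unfolding a sum over all
  periods into an integral over the line.\<close>

lemma integral_unfold_period:
  fixes F :: "int \<Rightarrow> real \<Rightarrow> real" and T :: nat and c :: int
  assumes cont: "\<And>i A. continuous_on A (F i)"
    and shift: "\<And>i k x. F (i + k * int T) x = F i (x - of_int k * real T)"
  shows "(\<Sum>i\<in>{c * int T..<(c + int n) * int T}. integral {0..real T} (F i))
    = (\<Sum>i\<in>{0..<int T}. integral {(1 - of_int c - real n) * real T..(1 - of_int c) * real T} (F i))"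
proof (induction n)
  case (Suc n)
  define k where "k = c + int n"
  have split: "{c * int T..<(c + int (Suc n)) * int T} = {c * int T..<k * int T} \<union> {k * int T..<(k + 1) * int T}"
  proof -
    have "c * int T \<le> k * int T" "k * int T \<le> (k + 1) * int T"
      by (auto simp: k_def algebra_simps)
    then have "{c * int T..<k * int T} \<union> {k * int T..<(k + 1) * int T} = {c * int T..<(k + 1) * int T}"
      by (rule ivl_disj_un_two)
    then show ?thesis by (simp add: k_def algebra_simps)
  qed
  have "(\<Sum>i\<in>{k * int T..<(k + 1) * int T}. integral {0..real T} (F i))
      = (\<Sum>i\<in>{0..<int T}. integral {0..real T} (F (i + k * int T)))"
    by (rule sum.reindex_bij_witness[of _ "\<lambda>i. i + k * int T" "\<lambda>i. i - k * int T"])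
       (auto simp: algebra_simps)
  \<comment> \<open>Block \<open>k\<close> lands immediately to the left of the interval already
    covered by the earlier blocks.\<close>
  also have "\<dots> = (\<Sum>i\<in>{0..<int T}. integral {- of_int k * real T..(1 - of_int k) * real T} (F i))"
  proof (rule sum.cong[OF refl])
    fix i
    have "integral {0..real T} (F (i + k * int T))
        = integral {- (- of_int k * real T) + - of_int k * real T..real T} (\<lambda>x. F i (x + - of_int k * real T))"
      by (simp add: shift[abs_def])
    also have "\<dots> = integral {- of_int k * real T..(1 - of_int k) * real T} (F i)"
      using integral_shift_real_ivl[of "- of_int k * real T" "- of_int k * real T" "(1 - of_int k) * real T" "F i"]
      by (simp add: algebra_simps)
    finally show "integral {0..real T} (F (i + k * int T)) = integral {- of_int k * real T..(1 - of_int k) * real T} (F i)" .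
  qed
  finally have "(\<Sum>i\<in>{c * int T..<(c + int (Suc n)) * int T}. integral {0..real T} (F i))
     = (\<Sum>i\<in>{0..<int T}. integral {(1 - of_int c - real n) * real T..(1 - of_int c) * real T} (F i)
        + integral {- of_int k * real T..(1 - of_int k) * real T} (F i))"
    unfolding split using Suc
    by (subst sum.union_disjoint) (auto simp: k_def sum.distrib)
  also have "\<dots> = (\<Sum>i\<in>{0..<int T}. integral {(1 - of_int c - real (Suc n)) * real T..(1 - of_int c) * real T} (F i))"
  proof (rule sum.cong[OF refl])
    fix i
    have "integral {- of_int k * real T..(1 - of_int k) * real T} (F i)
        + integral {(1 - of_int k) * real T..(1 - of_int c) * real T} (F i)
        = integral {- of_int k * real T..(1 - of_int c) * real T} (F i)"
      by (rule Henstock_Kurzweil_Integration.integral_combine)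
         (auto intro!: integrable_continuous_real cont mult_right_mono simp: k_def)
    then show "integral {(1 - of_int c - real n) * real T..(1 - of_int c) * real T} (F i)
        + integral {- of_int k * real T..(1 - of_int k) * real T} (F i)
        = integral {(1 - of_int c - real (Suc n)) * real T..(1 - of_int c) * real T} (F i)"
      by (simp add: k_def algebra_simps)
  qed
  finally show ?case .
qed simp

section \<open>Increments of the mollified potential\<close>

text \<open>The separation keeps the transition zones of half-width \<epsilon> around distinct
  points from overlapping.\<close>

locale mollified_points = periodic_points z T l
  for z :: "int \<Rightarrow> real" and T :: nat and l :: real +
  fixes \<rho> :: "real \<Rightarrow> real" and \<epsilon> :: real
  assumes moll: "mollifier \<rho>" and eps: "0 < \<epsilon>" and separated: "2 * \<epsilon> \<le> l"
begin

sublocale smoothed_step "step_eps \<rho> \<epsilon>" "rho_eps \<rho> \<epsilon>" \<epsilon>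
  by (rule smoothed_step_eps[OF moll eps])

abbreviation "H \<equiv> step_eps \<rho> \<epsilon>"
abbreviation "U \<equiv> u_eps \<rho> \<epsilon> (range z)"

text \<open>A bump of signed length \<open>h + z i - z (i + m)\<close> ending at \<open>z i\<close>.\<close>

definition cell :: "real \<Rightarrow> int \<Rightarrow> int \<Rightarrow> real \<Rightarrow> real" where
  "cell h m i x = H (x + h - z (i + m)) - H (x - z i)"

lemma cell_cont [continuous_intros]: "continuous_on A (cell h m i)"
  unfolding cell_def[abs_def] by (intro continuous_intros)

lemma cell_shift: "cell h m (i + k * int T) x = cell h m i (x - of_int k * real T)"
  using period_mult[of "i + m" k] period_mult[of i k]
  by (simp add: cell_def algebra_simps)

text \<open>Re-matching the steps changes the finite sum only at the ends of the window, where a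
  step is already 1 on the left and 0 on the right; the mismatch amounts to \<open>m\<close>. One
  threshold serves all x in the period.\<close>

lemma U_increment:
  obtains N :: int where "\<And>n x. N \<le> n \<Longrightarrow> 0 \<le> x \<Longrightarrow> x \<le> real T \<Longrightarrow>
    U (x + h) - U x = h - of_int m - (\<Sum>i\<in>{- n..<n}. cell h m i x)"
proof -
  define L where "L = real T + \<bar>h\<bar> + \<epsilon>"
  obtain N where N: "0 < N" "\<And>i. N \<le> i \<Longrightarrow> L < z i" "\<And>i. i \<le> - N \<Longrightarrow> z i < - L"
    using window by blast
  \<comment> \<open>The margin |m| keeps the shifted ends of the window beyond the range seen from x
    and x + h.\<close>
  show ?thesis
  proof (rule that[of "N + \<bar>m\<bar>"])
    fix n x assume n: "N + \<bar>m\<bar> \<le> n" and x: "0 \<le> x" "x \<le> real T"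
    have W: "i \<in> {- n..<n}" if "\<bar>z i\<bar> \<le> L" for i using N(2,3)[of i] n that by force
    have le: "- n \<le> n" using N(1) n by simp
    note U = u_eps_eq[OF moll eps finite_atLeastLessThan_int, of L, OF W]
    have "(\<Sum>i\<in>{- n..<n}. H (x + h - z (i + m)) - H (x + h - z i)) = of_int m * - 1"
    proof (rule sum_int_shift_const[OF le])
      fix i j assume ij: "\<bar>i - - n\<bar> \<le> \<bar>m\<bar>" "\<bar>j - n\<bar> \<le> \<bar>m\<bar>"
      have "z i < - L" by (rule N(3)) (use ij n in linarith)
      moreover have "L < z j" by (rule N(2)) (use ij n in linarith)
      ultimately show "H (x + h - z j) - H (x + h - z i) = - 1"
        using x H_left[of "x + h - z j"] H_right[of "x + h - z i"] by (simp add: L_def)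
    qed
    then have "(\<Sum>i\<in>{- n..<n}. H (x + h - z (i + m))) = (\<Sum>i\<in>{- n..<n}. H (x + h - z i)) - of_int m"
      by (simp add: sum_subtractf)
    moreover have "U (x + h) - U x = h - (\<Sum>i\<in>{- n..<n}. H (x + h - z i)) + (\<Sum>i\<in>{- n..<n}. H (x - z i))"
      using U[of x] U[of "x + h"] x by (simp add: L_def sum_subtractf)
    ultimately show "U (x + h) - U x = h - of_int m - (\<Sum>i\<in>{- n..<n}. cell h m i x)"
      by (simp add: cell_def sum_subtractf)
  qed
qed

text \<open>A positive cell \<open>i\<close> puts x + h beyond z(i+m) - \<epsilon> and x before z(i)
  + \<epsilon>; a negative cell \<open>j\<close> gives the reverse bounds. Then z(i+m) < z(j+m) + 2
  \<epsilon> and z(j) < z(i) + 2 \<epsilon>, and the separation forces both i \<le> j and j \<le>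
  i.\<close>

lemma cell_same_sign: "\<not> (0 < cell h m i x \<and> cell h m j x < 0)"
proof
  assume *: "0 < cell h m i x \<and> cell h m j x < 0"
  then have "H (x - z i) < H (x + h - z (i + m))" "H (x + h - z (j + m)) < H (x - z j)"
    by (auto simp: cell_def)
  then have "0 < H (x + h - z (i + m))" "H (x - z i) < 1" "H (x + h - z (j + m)) < 1" "0 < H (x - z j)"
    using H_bounds by (meson le_less_trans less_le_trans)+
  then have "- \<epsilon> < x + h - z (i + m)" "x - z i < \<epsilon>" "x + h - z (j + m) < \<epsilon>" "- \<epsilon> < x - z j"
    by (auto dest: H_posD H_less_1D)
  then have "z (i + m) < z (j + m) + l" "z j < z i + l" using separated by linarith+
  then have "i + m \<le> j + m" "j \<le> i" using spaced_less by (meson not_less)+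
  then have "i = j" by simp
  with * show False by auto
qed

lemma cell_sum_superadditive:
  assumes "convex_on UNIV f" "f 0 = 0"
  shows "(\<Sum>i\<in>I. f (cell h m i x)) \<le> f (\<Sum>i\<in>I. cell h m i x)"
  by (rule convex_superadditive_sum[OF assms]) (metis cell_same_sign not_less)

text \<open>Windows of whole periods make the unfolding exact once they cover the supports;
  \<open>N\<close> is arbitrary so that the threshold of \<open>U_increment\<close> can be met by
  the same \<open>n\<close>.\<close>

lemma integral_cells:
  assumes f: "continuous_on UNIV f" "f 0 = 0"
  obtains n where "N \<le> n"
    "(\<Sum>i\<in>{- n..<n}. integral {0..real T} (\<lambda>x. f (cell h m i x)))
     = (\<Sum>i\<in>{0..<int T}. bump f (h + z i - z (i + m)))"
proof -
  define t where "t i = h + z i - z (i + m)" for i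
  define B where "B = (\<Sum>i\<in>{0..<int T}. \<epsilon> + \<bar>t i\<bar> + \<bar>z i\<bar>)"
  have B: "\<epsilon> + \<bar>t i\<bar> + \<bar>z i\<bar> \<le> B" if "i \<in> {0..<int T}" for i
    unfolding B_def using eps by (intro member_le_sum[OF that]) auto
  have "0 \<le> B" unfolding B_def using eps by (intro sum_nonneg) auto
  \<comment> \<open>\<open>B\<close> bounds how far the T representative bumps reach; the extra 1
    compensates for the unfolded interval [(1-M)T, (1+M)T] being off-centre.\<close>
  define M where "M = nat \<lceil>B\<rceil> + nat N + 1"
  have cont: "continuous_on A (\<lambda>x. f (cell h m i x))" for A i
    by (intro continuous_on_compose2[OF f(1)] continuous_intros) auto
  have "(\<Sum>i\<in>{- int M * int T..<(- int M + int (2 * M)) * int T}. integral {0..real T} (\<lambda>x. f (cell h m i x)))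
    = (\<Sum>i\<in>{0..<int T}. integral {(1 - of_int (- int M) - real (2 * M)) * real T..(1 - of_int (- int M)) * real T} (\<lambda>x. f (cell h m i x)))"
    by (rule integral_unfold_period[OF cont]) (simp add: cell_shift)
  also have "\<dots> = (\<Sum>i\<in>{0..<int T}. bump f (t i))"
  proof (rule sum.cong[OF refl])
    fix i assume i: "i \<in> {0..<int T}"
    let ?a = "(1 - real M) * real T" and ?b = "(1 + real M) * real T"
    have "real M - 1 \<le> (real M - 1) * real T"
      using T_pos by (simp add: M_def mult_le_cancel_left1)
    moreover have "B \<le> real M - 1" using \<open>0 \<le> B\<close> by (simp add: M_def) linarith
    ultimately have M: "B \<le> (real M - 1) * real T" by simp
    have "integral {?a..?b} (\<lambda>x. f (cell h m i x)) = integral {?a - z i..?b - z i} (\<lambda>x. f (cell h m i (x + z i)))"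
      by (rule integral_shift_real_ivl[symmetric])
    also have "\<dots> = integral {?a - z i..?b - z i} (\<lambda>x. f (H (x + t i) - H x))"
      by (simp add: cell_def t_def algebra_simps)
    also have "\<dots> = bump f (t i)"
      using B[OF i] M T_pos by (intro bump_eq[symmetric] f) (auto simp: algebra_simps)
    finally show "integral {(1 - of_int (- int M) - real (2 * M)) * real T..(1 - of_int (- int M)) * real T} (\<lambda>x. f (cell h m i x)) = bump f (t i)"
      by simp
  qed
  finally have "(\<Sum>i\<in>{- (int M * int T)..<int M * int T}. integral {0..real T} (\<lambda>x. f (cell h m i x)))
     = (\<Sum>i\<in>{0..<int T}. bump f (t i))" by simp
  moreover have "N \<le> int M * int T"
  proof -
    have "int M * 1 \<le> int M * int T" using T_pos by (intro mult_left_mono) auto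
    moreover have "N \<le> int (nat N)" "int (nat N) \<le> int M"
      by (auto simp only: M_def of_nat_le_iff)
    ultimately show ?thesis by linarith
  qed
  ultimately show ?thesis using that unfolding t_def by blast
qed

lemma mean_cell_length: "(\<Sum>i\<in>{0..<int T}. h + z i - z (i + m)) = real T * (h - of_int m)"
proof -
  have "(\<Sum>i\<in>{0..<int T}. z (i + m) - z i) = of_int m * real T"
  proof (rule sum_int_shift_const)
    fix i j :: int assume "j - i = int T - 0"
    then have "j = i + int T" by simp
    then show "z j - z i = real T" using period by simp
  qed simp
  moreover have "(\<Sum>i\<in>{0..<int T}. h + z i - z (i + m)) = real T * h - (\<Sum>i\<in>{0..<int T}. z (i + m) - z i)"
    by (simp add: sum.distrib sum_subtractf)
  ultimately show ?thesis by (simp add: algebra_simps)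
qed

end

section \<open>Minimality at a fixed increment\<close>

text \<open>Subtracting the value at \<open>v = 0\<close> makes the function vanish there, which
  both superadditivity and integration of a bump over the line require.\<close>

definition excess :: "real \<Rightarrow> real \<Rightarrow> real \<Rightarrow> real" where
  "excess p c v = \<bar>c - v\<bar> powr p - \<bar>c\<bar> powr p"

lemma excess_zero: "excess p c 0 = 0"
  by (simp add: excess_def)

lemma excess_has_deriv:
  assumes "1 < p"
  shows "(excess p c has_real_derivative - apow_deriv p (c - v)) (at v)"
  unfolding excess_def[abs_def]
  by (rule derivative_eq_intros refl DERIV_chain2[OF apow_has_deriv[OF assms]] | simp)+

lemma excess_deriv_cont:
  assumes "1 < p"
  shows "continuous_on UNIV (\<lambda>v. - apow_deriv p (c - v))"
  by (intro continuous_intros continuous_on_compose2[OF continuous_on_apow_deriv[OF assms]]) auto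

lemma excess_deriv_strict_mono:
  assumes "1 < p"
  shows "strict_mono (\<lambda>v. - apow_deriv p (c - v))"
  using strict_monoD[OF strict_mono_apow_deriv[OF assms]] by (intro strict_monoI) simp

lemma excess_cont:
  assumes "1 < p"
  shows "continuous_on A (excess p c)"
  using excess_has_deriv[OF assms] by (meson DERIV_isCont continuous_at_imp_continuous_on)

lemma excess_convex:
  assumes "1 < p"
  shows "convex_on UNIV (excess p c)"
proof (rule convex_on_realI[OF connected_UNIV excess_has_deriv[OF assms]])
  fix x y :: real assume "x \<le> y"
  then show "- apow_deriv p (c - x) \<le> - apow_deriv p (c - y)"
    using monoD[OF strict_mono_mono[OF excess_deriv_strict_mono[OF assms]]] by blast
qed

context mollified_points
begin

definition slice :: "real \<Rightarrow> real \<Rightarrow> real" where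
  "slice p h = integral {0..real T} (\<lambda>x. \<bar>U (x + h) - U x\<bar> powr p)"

lemma U_cont_compose [continuous_intros]: "continuous_on A g \<Longrightarrow> continuous_on A (\<lambda>x. U (g x))"
  by (rule continuous_on_compose2[OF u_eps_cont[OF moll eps]]) auto

lemma slice_eq:
  assumes p: "1 < p"
  obtains n where
    "slice p h = real T * \<bar>h - of_int m\<bar> powr p +
       integral {0..real T} (\<lambda>x. excess p (h - of_int m) (\<Sum>i\<in>{- n..<n}. cell h m i x))"
    "(\<Sum>i\<in>{- n..<n}. integral {0..real T} (\<lambda>x. excess p (h - of_int m) (cell h m i x)))
       = (\<Sum>i\<in>{0..<int T}. bump (excess p (h - of_int m)) (h + z i - z (i + m)))"
proof -
  let ?f = "excess p (h - of_int m)"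
  obtain N where N: "\<And>n x. N \<le> n \<Longrightarrow> 0 \<le> x \<Longrightarrow> x \<le> real T \<Longrightarrow>
      U (x + h) - U x = h - of_int m - (\<Sum>i\<in>{- n..<n}. cell h m i x)"
    using U_increment by blast
  obtain n where n: "N \<le> n"
    "(\<Sum>i\<in>{- n..<n}. integral {0..real T} (\<lambda>x. ?f (cell h m i x)))
     = (\<Sum>i\<in>{0..<int T}. bump ?f (h + z i - z (i + m)))"
    using integral_cells[OF excess_cont[OF p] excess_zero] by blast
  have "slice p h = integral {0..real T} (\<lambda>x. \<bar>h - of_int m\<bar> powr p + ?f (\<Sum>i\<in>{- n..<n}. cell h m i x))"
    unfolding slice_def
    by (rule Henstock_Kurzweil_Integration.integral_cong) (simp add: N[OF n(1)] excess_def)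
  also have "\<dots> = real T * \<bar>h - of_int m\<bar> powr p + integral {0..real T} (\<lambda>x. ?f (\<Sum>i\<in>{- n..<n}. cell h m i x))"
    by (subst Henstock_Kurzweil_Integration.integral_add)
       (auto intro!: integrable_continuous_real continuous_on_compose2[OF excess_cont[OF p, of UNIV]] continuous_intros)
  finally show ?thesis using n(2) that by blast
qed

lemma slice_ge_bumps:
  assumes p: "1 < p"
  shows "real T * \<bar>h - of_int m\<bar> powr p
      + (\<Sum>i\<in>{0..<int T}. bump (excess p (h - of_int m)) (h + z i - z (i + m))) \<le> slice p h"
proof -
  let ?f = "excess p (h - of_int m)"
  obtain n where n: "slice p h = real T * \<bar>h - of_int m\<bar> powr p +
       integral {0..real T} (\<lambda>x. ?f (\<Sum>i\<in>{- n..<n}. cell h m i x))"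
    "(\<Sum>i\<in>{- n..<n}. integral {0..real T} (\<lambda>x. ?f (cell h m i x)))
       = (\<Sum>i\<in>{0..<int T}. bump ?f (h + z i - z (i + m)))"
    using slice_eq[OF p] by blast
  note int = integrable_continuous_real continuous_on_compose2[OF excess_cont[OF p, of UNIV]] continuous_intros
  have "(\<Sum>i\<in>{- n..<n}. integral {0..real T} (\<lambda>x. ?f (cell h m i x)))
      = integral {0..real T} (\<lambda>x. \<Sum>i\<in>{- n..<n}. ?f (cell h m i x))"
    by (rule Henstock_Kurzweil_Integration.integral_sum[symmetric]) (auto intro!: int)
  also have "\<dots> \<le> integral {0..real T} (\<lambda>x. ?f (\<Sum>i\<in>{- n..<n}. cell h m i x))"
    by (intro integral_le cell_sum_superadditive excess_convex[OF p] excess_zero) (auto intro!: int)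
  finally show ?thesis using n by linarith
qed

lemma bump_excess:
  assumes p: "1 < p"
  shows "(bump (excess p c) has_real_derivative bump_deriv (\<lambda>v. - apow_deriv p (c - v)) t) (at t)"
    and "mono (bump_deriv (\<lambda>v. - apow_deriv p (c - v)))"
    and "0 < t \<Longrightarrow> bump_deriv (\<lambda>v. - apow_deriv p (c - v)) 0 < bump_deriv (\<lambda>v. - apow_deriv p (c - v)) t"
  by (rule bump_has_deriv excess_has_deriv excess_deriv_cont excess_zero bump_deriv_mono
        bump_deriv_strict excess_deriv_strict_mono strict_mono_mono p | assumption)+

text \<open>Jensen at the mean length h - m. No relation between \<open>m\<close> and
  \<open>h\<close> is imposed, so the bound can later be matched with the equispaced value.\<close>

lemma slice_lower_bound:
  assumes p: "1 < p"
  shows "real T * (\<bar>h - of_int m\<bar> powr p + bump (excess p (h - of_int m)) (h - of_int m)) \<le> slice p h"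
  using sum_above_tangent(1)[OF bump_excess(1,2)[OF p, of "h - of_int m"], where I = "{0..<int T}" and t = "\<lambda>i. h + z i - z (i + m)" and c = "h - of_int m"]
    slice_ge_bumps[OF p, of h m] mean_cell_length[of h m]
  by (simp add: algebra_simps)

text \<open>For m = 1 the cell at the large gap has negative length while the mean h - 1 is
  positive, and the bump derivative strictly increases from 0 to that mean.\<close>

lemma slice_lower_bound_strict:
  assumes p: "1 < p" and j: "j \<in> {0..<int T}" and h: "1 < h" "h < z (j + 1) - z j"
  shows "real T * (\<bar>h - 1\<bar> powr p + bump (excess p (h - 1)) (h - 1)) < slice p h"
  using sum_above_tangent(2)[OF bump_excess(1,2)[OF p, of "h - 1"], where I = "{0..<int T}" and t = "\<lambda>i. h + z i - z (i + 1)" and c = "h - 1" and j = j]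
    slice_ge_bumps[OF p, of h 1] mean_cell_length[of h 1] bump_excess(3)[OF p, of "h - 1" "h - 1"] j h
  by (simp add: algebra_simps)

text \<open>On an equispaced configuration the cells have width at most \<open>1/2 + 2 * \<epsilon> \<le> 1\<close> when \<open>m\<close> is
  the integer nearest to \<open>h\<close>, so they do not overlap and the superadditivity is an equality.\<close>

lemma equispaced_cells_disjoint:
  assumes z: "\<And>i. z i = a + of_int i" and \<epsilon>: "\<epsilon> \<le> 1/4" and h: "\<bar>h - of_int m\<bar> \<le> 1/2"
    and "cell h m i x \<noteq> 0" "cell h m j x \<noteq> 0"
  shows "i = j"
proof -
  have "x - z k \<in> {min (- (h - of_int m)) 0 - \<epsilon><..<max (- (h - of_int m)) 0 + \<epsilon>}" if "cell h m k x \<noteq> 0" for k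
  proof (rule ccontr)
    assume "\<not> ?thesis"
    from step_diff_zero[OF this] that show False by (simp add: cell_def z algebra_simps)
  qed
  from this[OF assms(4)] this[OF assms(5)]
  have "\<bar>real_of_int i - real_of_int j\<bar> < 1" using \<epsilon> h
    by (auto simp: z min_def max_def abs_if split: if_splits)
  then show ?thesis by linarith
qed

text \<open>At most one cell is active at x. Quantifying over \<open>f\<close> lets the same
  \<open>k\<close> serve for the plain sum and for the sum of excesses.\<close>

lemma equispaced_cell_sum:
  assumes z: "\<And>i. z i = a + of_int i" and \<epsilon>: "\<epsilon> \<le> 1/4" and h: "\<bar>h - of_int m\<bar> \<le> 1/2"
    and I: "finite I"
  obtains "\<And>i. i \<in> I \<Longrightarrow> cell h m i x = 0"
  | k where "k \<in> I" "\<And>f :: real \<Rightarrow> real. f 0 = 0 \<Longrightarrow> (\<Sum>i\<in>I. f (cell h m i x)) = f (cell h m k x)"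
proof (cases "\<exists>k\<in>I. cell h m k x \<noteq> 0")
  case True
  then obtain k where k: "k \<in> I" "cell h m k x \<noteq> 0" by blast
  have "(\<Sum>i\<in>I. f (cell h m i x)) = f (cell h m k x)" if "f 0 = 0" for f :: "real \<Rightarrow> real"
  proof -
    have "f (cell h m i x) = 0" if "i \<noteq> k" for i
      using equispaced_cells_disjoint[OF z \<epsilon> h _ k(2)] that \<open>f 0 = 0\<close> by metis
    then show ?thesis using I k(1) by (simp add: sum.remove[of I k])
  qed
  with k(1) that(2) show ?thesis by blast
qed (use that(1) in blast)

lemma slice_equispaced:
  assumes p: "1 < p" and z: "\<And>i. z i = a + of_int i" and \<epsilon>: "\<epsilon> \<le> 1/4" and h: "\<bar>h - of_int m\<bar> \<le> 1/2"
  shows "slice p h = real T * (\<bar>h - of_int m\<bar> powr p + bump (excess p (h - of_int m)) (h - of_int m))"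
proof -
  let ?f = "excess p (h - of_int m)"
  obtain n where n: "slice p h = real T * \<bar>h - of_int m\<bar> powr p +
       integral {0..real T} (\<lambda>x. ?f (\<Sum>i\<in>{- n..<n}. cell h m i x))"
    "(\<Sum>i\<in>{- n..<n}. integral {0..real T} (\<lambda>x. ?f (cell h m i x)))
       = (\<Sum>i\<in>{0..<int T}. bump ?f (h + z i - z (i + m)))"
    using slice_eq[OF p] by blast
  note int = integrable_continuous_real continuous_on_compose2[OF excess_cont[OF p, of UNIV]] continuous_intros
  have "?f (\<Sum>i\<in>{- n..<n}. cell h m i x) = (\<Sum>i\<in>{- n..<n}. ?f (cell h m i x))" for x
  proof (cases rule: equispaced_cell_sum[OF z \<epsilon> h finite_atLeastLessThan_int, of "- n" n x])
    case 1
    then show ?thesis by (simp add: excess_zero)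
  next
    case (2 k)
    then show ?thesis using 2(2)[of "\<lambda>v. v"] 2(2)[of ?f] by (simp add: excess_zero)
  qed
  then have "integral {0..real T} (\<lambda>x. ?f (\<Sum>i\<in>{- n..<n}. cell h m i x))
      = integral {0..real T} (\<lambda>x. \<Sum>i\<in>{- n..<n}. ?f (cell h m i x))" by simp
  also have "\<dots> = (\<Sum>i\<in>{- n..<n}. integral {0..real T} (\<lambda>x. ?f (cell h m i x)))"
    by (rule Henstock_Kurzweil_Integration.integral_sum) (auto intro!: int)
  also have "\<dots> = real T * bump ?f (h - of_int m)" by (simp add: n(2) z)
  finally show ?thesis using n(1) by (simp add: algebra_simps)
qed

section \<open>Size of equispaced slices for small and large increments\<close>

lemma cell_bounds:
  obtains C where "0 \<le> C" "\<And>h m i x. \<bar>cell h m i x\<bar> \<le> 1" "\<And>h i x. \<bar>cell h 0 i x\<bar> \<le> C * \<bar>h\<bar>"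
proof -
  have "bounded (rho_eps \<rho> \<epsilon> ` {- \<epsilon>..\<epsilon>})"
    by (intro compact_imp_bounded compact_continuous_image continuous_intros) auto
  then obtain C where "\<forall>v\<in>rho_eps \<rho> \<epsilon> ` {- \<epsilon>..\<epsilon>}. norm v \<le> C"
    unfolding bounded_iff by blast
  then have C: "\<bar>rho_eps \<rho> \<epsilon> y\<bar> \<le> C" if "y \<in> {- \<epsilon>..\<epsilon>}" for y
    using that by auto
  have C0: "0 \<le> C" using C[of 0] eps by simp
  have r_bound: "\<bar>rho_eps \<rho> \<epsilon> y\<bar> \<le> C" for y
    using C[of y] C0 r_zero[of y] by (cases "\<bar>y\<bar> \<le> \<epsilon>") (auto simp: abs_le_iff)
  show ?thesis
  proof (rule that[OF C0])
    show "\<bar>cell h m i x\<bar> \<le> 1" for h m i x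
      using H_bounds[of "x + h - z (i + m)"] H_bounds[of "x - z i"] by (auto simp: cell_def)
    show "\<bar>cell h 0 i x\<bar> \<le> C * \<bar>h\<bar>" for h i x
      using field_differentiable_bound[of UNIV H "rho_eps \<rho> \<epsilon>" C "x - z i" "x + h - z i"] H_deriv r_bound
      by (simp add: cell_def)
  qed
qed

lemma slice_le:
  assumes p: "0 < p" and b: "\<And>x. 0 \<le> x \<Longrightarrow> x \<le> real T \<Longrightarrow> \<bar>U (x + h) - U x\<bar> \<le> b"
  shows "slice p h \<le> real T * b powr p"
proof -
  have "slice p h \<le> integral {0..real T} (\<lambda>x. b powr p)"
    unfolding slice_def using b p
    by (intro integral_le integrable_continuous_real)
       (auto intro!: continuous_intros continuous_on_powr' powr_mono2)
  then show ?thesis by simp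
qed

text \<open>The uniform bound controls the tail of the energy; the bound by |h|^p, from the
  Lipschitz constant of the step and m = 0, controls the singularity at h = 0.\<close>

lemma equispaced_slice_bounds:
  assumes p: "1 < p" and z: "\<And>i. z i = a + of_int i" and \<epsilon>: "\<epsilon> \<le> 1/4"
  obtains C where "0 \<le> C" "\<And>h. slice p h \<le> C" "\<And>h. \<bar>h\<bar> \<le> 1/2 \<Longrightarrow> slice p h \<le> C * \<bar>h\<bar> powr p"
proof -
  obtain K where K: "0 \<le> K" "\<And>h m i x. \<bar>cell h m i x\<bar> \<le> 1" "\<And>h i x. \<bar>cell h 0 i x\<bar> \<le> K * \<bar>h\<bar>"
    using cell_bounds by blast
  have U_le: "\<bar>U (x + h) - U x\<bar> \<le> \<bar>h - of_int m\<bar> + b"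
    if m: "\<bar>h - of_int m\<bar> \<le> 1/2" and b: "0 \<le> b" "\<And>i. \<bar>cell h m i x\<bar> \<le> b" and x: "0 \<le> x" "x \<le> real T"
    for x h m b
  proof -
    obtain N where N: "\<And>n x. N \<le> n \<Longrightarrow> 0 \<le> x \<Longrightarrow> x \<le> real T \<Longrightarrow>
        U (x + h) - U x = h - of_int m - (\<Sum>i\<in>{- n..<n}. cell h m i x)"
      using U_increment by blast
    have "\<bar>\<Sum>i\<in>{- N..<N}. cell h m i x\<bar> \<le> b"
    proof (cases rule: equispaced_cell_sum[OF z \<epsilon> m finite_atLeastLessThan_int, of "- N" N x])
      case (2 k)
      then show ?thesis using 2(2)[of "\<lambda>v. v"] b by simp
    qed (use b in auto)
    then show ?thesis using N[OF order_refl x] by linarith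
  qed
  \<comment> \<open>2 exceeds 1/2 + 1, from the nearest integer and one active cell; 1 + K comes
    from |h| + K |h| for m = 0.\<close>
  define C where "C = real T * (max 2 (1 + K)) powr p"
  show ?thesis
  proof (rule that[of C])
    show "0 \<le> C" by (simp add: C_def)
    show "slice p h \<le> C" for h
    proof -
      have r: "\<bar>h - of_int (round h)\<bar> \<le> 1/2"
        using of_int_round_abs_le[of h] by (simp add: abs_minus_commute)
      have "slice p h \<le> real T * 2 powr p"
      proof (rule slice_le)
        fix x assume "0 \<le> x" "x \<le> real T"
        from U_le[OF r _ K(2) this] r show "\<bar>U (x + h) - U x\<bar> \<le> 2" by simp
      qed (use p in simp)
      also have "\<dots> \<le> C"
        unfolding C_def using p by (intro mult_left_mono powr_mono2) auto
      finally show ?thesis .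
    qed
    show "slice p h \<le> C * \<bar>h\<bar> powr p" if h: "\<bar>h\<bar> \<le> 1/2" for h
    proof -
      have "slice p h \<le> real T * ((1 + K) * \<bar>h\<bar>) powr p"
      proof (rule slice_le)
        fix x assume "0 \<le> x" "x \<le> real T"
        from U_le[OF _ _ K(3) this] h K(1) show "\<bar>U (x + h) - U x\<bar> \<le> (1 + K) * \<bar>h\<bar>"
          by (simp add: algebra_simps)
      qed (use p in simp)
      also have "\<dots> = real T * (1 + K) powr p * \<bar>h\<bar> powr p"
        using K(1) by (simp add: powr_mult)
      also have "\<dots> \<le> C * \<bar>h\<bar> powr p"
        unfolding C_def using p K(1) by (intro mult_right_mono mult_left_mono powr_mono2) auto
      finally show ?thesis .
    qed
  qed
qed

lemma slice_has_integral:
  assumes "0 < p"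
  shows "((\<lambda>x. \<bar>U (x + h) - U x\<bar> powr p) has_integral slice p h) {0..real T}"
  unfolding slice_def
  by (intro integrable_integral integrable_continuous_real continuous_on_powr' continuous_intros)
     (use assms in auto)

lemma slice_nonneg: "0 < p \<Longrightarrow> 0 \<le> slice p h"
  by (rule has_integral_nonneg[OF slice_has_integral]) auto

end

section \<open>The energy as an integral over increments\<close>

context mollified_points
begin

lemma U_measurable [measurable]: "U \<in> borel_measurable borel"
  by (rule borel_measurable_continuous_onI[OF u_eps_cont[OF moll eps]])

lemma slice_nn_integral:
  assumes "0 < p"
  shows "(\<integral>\<^sup>+ x. ennreal (\<bar>U (x + h) - U x\<bar> powr p) * indicator {0..<real T} x \<partial>lborel) = ennreal (slice p h)"
proof -
  \<comment> \<open>The energy integrates over a half-open period and \<open>slice\<close> over a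
    closed one; they differ by a null set.\<close>
  have "(\<integral>\<^sup>+ x. ennreal (\<bar>U (x + h) - U x\<bar> powr p) * indicator {0..<real T} x \<partial>lborel)
      = (\<integral>\<^sup>+ x. ennreal (indicator {0..real T} x * \<bar>U (x + h) - U x\<bar> powr p) \<partial>lborel)"
    by (rule nn_integral_cong_AE, rule AE_mp[OF AE_lborel_singleton[of "real T"]])
       (auto simp: indicator_def)
  also have "\<dots> = ennreal (slice p h)"
    by (rule nn_integral_has_integral_lebesgue[OF _ slice_has_integral[OF assms]]) auto
  finally show ?thesis .
qed

lemma slice_measurable:
  assumes "0 < p"
  shows "(\<lambda>h. ennreal (slice p h)) \<in> borel_measurable borel"
  unfolding slice_nn_integral[OF assms, symmetric] by measurable

lemma energy_eq_slices:
  assumes p: "0 < p"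
  shows "energy \<rho> \<epsilon> s p T (range z) = (\<integral>\<^sup>+ h. ennreal (slice p h) * ennreal (1 / \<bar>h\<bar> powr (1 + s * p)) \<partial>lborel)"
proof -
  \<comment> \<open>At h = 0 this weight takes the default value 1 / 0 = 0, as the integrand of
    \<open>energy\<close> does on the diagonal.\<close>
  let ?w = "\<lambda>h. ennreal (1 / \<bar>h\<bar> powr (1 + s * p))"
  let ?d = "\<lambda>x h. ennreal (\<bar>U (x + h) - U x\<bar> powr p)"
  have inner: "(\<integral>\<^sup>+ y. ennreal (\<bar>U x - U y\<bar> powr p / \<bar>x - y\<bar> powr (1 + s * p)) \<partial>lborel)
      = (\<integral>\<^sup>+ h. ?d x h * ?w h \<partial>lborel)" for x
    by (subst nn_integral_real_affine[of _ 1 x])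
       (auto simp: ennreal_mult[symmetric] abs_minus_commute intro!: nn_integral_cong)
  have "energy \<rho> \<epsilon> s p T (range z)
      = (\<integral>\<^sup>+ x. (\<integral>\<^sup>+ h. ?d x h * ?w h * indicator {0..<real T} x \<partial>lborel) \<partial>lborel)"
    unfolding energy_def inner by (simp add: nn_integral_multc)
  also have "\<dots> = (\<integral>\<^sup>+ h. (\<integral>\<^sup>+ x. ?d x h * ?w h * indicator {0..<real T} x \<partial>lborel) \<partial>lborel)"
    by (rule lborel_pair.Fubini') measurable
  also have "\<dots> = (\<integral>\<^sup>+ h. (\<integral>\<^sup>+ x. ?d x h * indicator {0..<real T} x * ?w h \<partial>lborel) \<partial>lborel)"
    by (simp add: ac_simps)
  also have "\<dots> = (\<integral>\<^sup>+ h. ennreal (slice p h) * ?w h \<partial>lborel)"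
    unfolding slice_nn_integral[OF p, symmetric] by (simp add: nn_integral_multc)
  finally show ?thesis .
qed

end

section \<open>Finite energy of equispaced configurations\<close>

lemma nn_integral_powr_tails_finite:
  fixes a e :: real
  assumes "- 1 < a" "e < - 1"
  shows "(\<integral>\<^sup>+ h. ennreal (indicator {0..1/2} h * h powr a) + ennreal (indicator {1/2..} h * h powr e) \<partial>lborel) < \<infinity>"
proof -
  have "(\<integral>\<^sup>+ h. ennreal (indicator {0..1/2} h * h powr a) \<partial>lborel) = ennreal ((1/2) powr (a + 1) / (a + 1))"
    by (rule nn_integral_has_integral_lebesgue[OF _ has_integral_powr_from_0]) (use assms in auto)
  moreover have "(\<integral>\<^sup>+ h. ennreal (indicator {1/2..} h * h powr e) \<partial>lborel) = ennreal (- ((1/2) powr (e + 1)) / (e + 1))"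
    by (rule nn_integral_has_integral_lebesgue[OF _ has_integral_powr_to_inf]) (use assms in auto)
  ultimately show ?thesis by (subst nn_integral_add) auto
qed

text \<open>Near 0 the integrand is of order |h|^(p - 1 - sp), integrable because s < 1; away from 0
  it decays like |h|^(-1 - sp).\<close>

lemma (in mollified_points) equispaced_energy_finite:
  assumes p: "1 < p" and s: "s < 1" and sp: "1 \<le> s * p"
    and z: "\<And>i. z i = a + of_int i" and \<epsilon>: "\<epsilon> \<le> 1/4"
  shows "energy \<rho> \<epsilon> s p T (range z) < \<infinity>"
proof -
  define q where "q = 1 + s * p"
  have q: "q < p + 1" "1 < q" using p s sp by (auto simp: q_def)
  obtain C where C: "0 \<le> C" "\<And>h. slice p h \<le> C" "\<And>h. \<bar>h\<bar> \<le> 1/2 \<Longrightarrow> slice p h \<le> C * \<bar>h\<bar> powr p"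
    using equispaced_slice_bounds[OF p z \<epsilon>] by blast
  \<comment> \<open>A majorant living on h \<ge> 0; adding its reflection covers negative
    increments.\<close>
  define G where "G h = ennreal (indicator {0..1/2} h * h powr (p - q)) + ennreal (indicator {1/2..} h * h powr (- q))" for h :: real
  have G_abs: "G \<bar>h\<bar> \<le> G h + G (- h)" for h by (cases "0 \<le> h") auto
  have G_meas [measurable]: "G \<in> borel_measurable borel" unfolding G_def[abs_def] by measurable
  have bound: "ennreal (slice p h) * ennreal (1 / \<bar>h\<bar> powr q) \<le> ennreal C * (G h + G (- h))" for h
  proof -
    have "ennreal (slice p h) * ennreal (1 / \<bar>h\<bar> powr q) = ennreal (slice p h / \<bar>h\<bar> powr q)"
      using slice_nonneg[of p h] p by (simp add: ennreal_mult[symmetric])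
    also have "\<dots> \<le> ennreal C * G \<bar>h\<bar>"
    proof (cases "\<bar>h\<bar> \<le> 1/2")
      case True
      have "slice p h / \<bar>h\<bar> powr q \<le> C * \<bar>h\<bar> powr p / \<bar>h\<bar> powr q"
        by (intro divide_right_mono C(3) True) simp
      then have "ennreal (slice p h / \<bar>h\<bar> powr q) \<le> ennreal (C * \<bar>h\<bar> powr (p - q))"
        by (intro ennreal_leI) (simp add: powr_diff)
      also have "\<dots> = ennreal C * ennreal (\<bar>h\<bar> powr (p - q))" using C(1) by (rule ennreal_mult) simp
      also have "\<dots> \<le> ennreal C * G \<bar>h\<bar>"
        using True by (intro mult_left_mono) (auto simp: G_def)
      finally show ?thesis .
    next
      case False
      have "slice p h / \<bar>h\<bar> powr q \<le> C / \<bar>h\<bar> powr q"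
        by (intro divide_right_mono C(2)) simp
      then have "ennreal (slice p h / \<bar>h\<bar> powr q) \<le> ennreal (C * \<bar>h\<bar> powr (- q))"
        by (intro ennreal_leI) (simp add: powr_minus divide_inverse)
      also have "\<dots> = ennreal C * ennreal (\<bar>h\<bar> powr (- q))" using C(1) by (rule ennreal_mult) simp
      also have "\<dots> \<le> ennreal C * G \<bar>h\<bar>"
        using False by (intro mult_left_mono) (auto simp: G_def)
      finally show ?thesis .
    qed
    also have "\<dots> \<le> ennreal C * (G h + G (- h))" by (intro mult_left_mono G_abs) simp
    finally show ?thesis .
  qed
  have fin: "(\<integral>\<^sup>+ h. G h \<partial>lborel) < \<infinity>"
    unfolding G_def by (rule nn_integral_powr_tails_finite) (use q in auto)
  moreover have "(\<integral>\<^sup>+ h. G (- h) \<partial>lborel) = (\<integral>\<^sup>+ h. G h \<partial>lborel)"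
    using nn_integral_real_affine[of G "- 1" 0] by simp
  ultimately have "(\<integral>\<^sup>+ h. ennreal C * (G h + G (- h)) \<partial>lborel) < \<infinity>"
    by (simp add: nn_integral_cmult nn_integral_add ennreal_mult_less_top)
  moreover have "energy \<rho> \<epsilon> s p T (range z) \<le> (\<integral>\<^sup>+ h. ennreal C * (G h + G (- h)) \<partial>lborel)"
    using energy_eq_slices[of p s] p bound by (simp add: q_def nn_integral_mono)
  ultimately show ?thesis by (rule le_less_trans[rotated])
qed

section \<open>Configurations\<close>

lemma min_dist_le:
  assumes "i < T" "j < T" "(i, k) \<noteq> (j, m)"
  shows "min_dist T x \<le> \<bar>(x i + real_of_int k * real T) - (x j + real_of_int m * real T)\<bar>"
  unfolding min_dist_def
  by (rule cInf_lower) (use assms in \<open>auto intro!: bdd_belowI[of _ 0]\<close>)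

text \<open>Quotient and remainder modulo T select the periodic copy and the representative.\<close>

lemma config_class_obtain_points:
  assumes X: "X \<in> config_class T l" and T: "1 \<le> T" and l: "0 < l"
  obtains z where "periodic_points z T l" "X = range z"
proof -
  obtain x where x: "\<And>i. i < T \<Longrightarrow> 0 \<le> x i \<and> x i < real T" "\<And>i j. i \<le> j \<Longrightarrow> j < T \<Longrightarrow> x i \<le> x j"
    "X = {x i + real_of_int k * real T | i k. i < T}" "l \<le> min_dist T x"
    using X unfolding config_class_def by blast
  define z where "z i = x (nat (i mod int T)) + of_int (i div int T) * real T" for i
  have zi: "z (int i + k * int T) = x i + of_int k * real T" if "i < T" for i k
    using that T by (simp add: z_def)
  have mod: "\<exists>i' k. i = int i' + k * int T \<and> i' < T" for i
    using T by (intro exI[of _ "nat (i mod int T)"] exI[of _ "i div int T"]) (simp add: nat_less_iff)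
  have "periodic_points z T l"
  proof
    fix i
    obtain j k where i: "i = int j + k * int T" and j: "j < T" using mod by blast
    have "z (i + int T) = z (int j + (k + 1) * int T)" by (simp add: i algebra_simps)
    then show "z (i + int T) = z i + real T"
      unfolding zi[OF j] by (simp add: i zi[OF j] algebra_simps)
    show "z i + l \<le> z (i + 1)"
    proof (cases "Suc j < T")
      case True
      have "i + 1 = int (Suc j) + k * int T" by (simp add: i)
      then have "z (i + 1) = x (Suc j) + of_int k * real T" using zi[OF True] by metis
      moreover have "l \<le> \<bar>(x (Suc j) + real_of_int 0 * real T) - (x j + real_of_int 0 * real T)\<bar>"
        by (rule order_trans[OF x(4) min_dist_le]) (use True in auto)
      moreover have "x j \<le> x (Suc j)" using x(2) True by simp
      ultimately show ?thesis by (simp add: i zi[OF j])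
    next
      case False
      \<comment> \<open>The successor of the last representative is the first one moved by a period.
        The minimal distance sees this pair even for T = 1, where both are copies of one
        point.\<close>
      then have Tj: "T = Suc j" using j by simp
      have "i + 1 = int 0 + (k + 1) * int T" by (simp add: i Tj algebra_simps)
      then have "z (i + 1) = x 0 + of_int (k + 1) * real T" using zi[of 0 "k + 1"] T by simp
      moreover have "l \<le> \<bar>(x 0 + real_of_int 1 * real T) - (x j + real_of_int 0 * real T)\<bar>"
        by (rule order_trans[OF x(4) min_dist_le]) (use j in auto)
      moreover have "x j < x 0 + real T" using x(1)[of j] x(1)[of 0] j by simp
      ultimately show ?thesis by (simp add: i zi[OF j] algebra_simps)
    qed
  qed (use T l in auto)
  moreover have "X = range z"
  proof -
    have "X \<subseteq> range z" unfolding x(3) using zi by (auto simp: image_iff) metis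
    moreover have "range z \<subseteq> X" unfolding x(3) using zi mod by (auto, metis)
    ultimately show ?thesis by blast
  qed
  ultimately show ?thesis using that by blast
qed

lemma Ints_in_config_class:
  assumes T: "1 \<le> T" and l: "l \<le> 1"
  shows "(\<int> :: real set) \<in> config_class T l"
proof -
  have eq: "(\<int> :: real set) = {real i + real_of_int k * real T | i k. i < T}"
  proof (intro set_eqI iffI)
    fix x :: real assume "x \<in> \<int>"
    then obtain n where n: "x = of_int n" by (auto elim: Ints_cases)
    have "x = of_int (n mod int T + n div int T * int T)" by (simp add: n)
    also have "\<dots> = of_int (n mod int T) + of_int (n div int T) * real T"
      unfolding of_int_add of_int_mult by simp
    also have "real_of_int (n mod int T) = real (nat (n mod int T))" using T by simp
    finally have "x = real (nat (n mod int T)) + real_of_int (n div int T) * real T" .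
    moreover have "nat (n mod int T) < T" using T by (simp add: nat_less_iff)
    ultimately show "x \<in> {real i + real_of_int k * real T | i k. i < T}" by blast
  qed auto
  have "1 \<le> min_dist T real"
    unfolding min_dist_def
  proof (rule cInf_greatest)
    \<comment> \<open>Two copies of a single point witness nonemptiness even when T = 1.\<close>
    have "\<bar>(real 0 + real_of_int 0 * real T) - (real 0 + real_of_int 1 * real T)\<bar> \<in>
      {\<bar>(real i + real_of_int k * real T) - (real j + real_of_int m * real T)\<bar> | i j k m.
        i < T \<and> j < T \<and> (i, k) \<noteq> (j, m)}"
      using T by (intro CollectI exI conjI) (rule refl, auto)
    then show "{\<bar>(real i + real_of_int k * real T) - (real j + real_of_int m * real T)\<bar> | i j k m.
        i < T \<and> j < T \<and> (i, k) \<noteq> (j, m)} \<noteq> {}" by blast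
  next
    fix d assume "d \<in> {\<bar>(real i + real_of_int k * real T) - (real j + real_of_int m * real T)\<bar> | i j k m.
        i < T \<and> j < T \<and> (i, k) \<noteq> (j, m)}"
    then obtain i j k m where d: "d = \<bar>(real i + real_of_int k * real T) - (real j + real_of_int m * real T)\<bar>"
      and ij: "i < T" "j < T" "(i, k) \<noteq> (j, m)" by blast
    \<comment> \<open>The residue modulo T recovers the representative, and then the copy; distinct
      integers are at least 1 apart.\<close>
    have "int i + k * int T \<noteq> int j + m * int T"
    proof
      assume *: "int i + k * int T = int j + m * int T"
      then have "(int i + k * int T) mod int T = (int j + m * int T) mod int T" by simp
      then have "i = j" using ij by simp
      with * ij show False by simp
    qed
    then have "1 \<le> \<bar>(int i + k * int T) - (int j + m * int T)\<bar>" by linarith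
    then have "1 \<le> real_of_int \<bar>(int i + k * int T) - (int j + m * int T)\<bar>" by linarith
    then show "1 \<le> d" by (simp add: d)
  qed
  then show ?thesis
    unfolding config_class_def using l eq by (auto intro!: exI[of _ real])
qed

text \<open>The T gaps in a period sum to T, so if none exceeds 1 then all equal 1.\<close>

lemma (in periodic_points) equispaced_or_large_gap:
  obtains "\<And>i. z i = z 0 + of_int i" | j where "j \<in> {0..<int T}" "1 < z (j + 1) - z j"
proof (cases "\<exists>j\<in>{0..<int T}. 1 < z (j + 1) - z j")
  case False
  have "(\<Sum>i\<in>{0..<int T}. z (i + 1) - z i) = real T"
    using sum_int_telescope[of 0 "int T" z] period[of 0] by simp
  then have "(\<Sum>i\<in>{0..<int T}. 1 - (z (i + 1) - z i)) = 0" by (simp add: sum_subtractf)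
  then have gaps0: "z (i + 1) - z i = 1" if "i \<in> {0..<int T}" for i
    using False that by (subst (asm) sum_nonneg_eq_0_iff) (auto simp: not_less)
  have gaps: "z (i + 1) = z i + 1" for i
  proof -
    have "z (i mod int T + 1) - z (i mod int T) = 1" using T_pos by (intro gaps0) simp
    moreover have "i = i mod int T + i div int T * int T" by simp
    ultimately show ?thesis
      using period_mult[of "i mod int T + 1" "i div int T"] period_mult[of "i mod int T" "i div int T"]
      by (simp add: algebra_simps)
  qed
  have "z i = z 0 + of_int i" for i
  proof (induction i rule: int_induct[where k = 0])
    case (step1 i)
    then show ?case using gaps[of i] by simp
  next
    case (step2 i)
    then show ?case using gaps[of "i - 1"] by simp
  qed simp
  then show ?thesis using that(1) by blast
qed (use that(2) in blast)

lemma periodic_points_equispaced: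
  assumes "1 \<le> T" "0 < l" "l \<le> 1"
  shows "periodic_points (\<lambda>i. a + of_int i) T l"
  by unfold_locales (use assms in auto)

lemma range_equispaced: "range (\<lambda>i. a + of_int i) = (\<lambda>x. x + a) ` (\<int> :: real set)"
  by (auto simp: Ints_def image_image add.commute)

theorem mainTheorem10:
  fixes \<rho> :: "real \<Rightarrow> real" and \<epsilon> s p :: real and T :: nat
  assumes "mollifier \<rho>"
    and "0 < \<epsilon>" and "\<epsilon> \<le> 1/4"
    and "1 \<le> p" and "0 < s" and "s < 1" and "1 \<le> s * p"
    and "1 \<le> T"
  shows "(\<int> :: real set) \<in> config_class T (4 * \<epsilon>) \<and>
    (\<forall>X \<in> config_class T (4 * \<epsilon>).
       energy \<rho> \<epsilon> s p T \<int> \<le> energy \<rho> \<epsilon> s p T X \<and>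
       (energy \<rho> \<epsilon> s p T X = energy \<rho> \<epsilon> s p T \<int> \<longleftrightarrow> (\<exists>a. X = (\<lambda>x. x + a) ` \<int>)))"
proof (intro conjI ballI)
  show "(\<int> :: real set) \<in> config_class T (4 * \<epsilon>)"
    using assms by (intro Ints_in_config_class) auto
next
  fix X assume X: "X \<in> config_class T (4 * \<epsilon>)"
  \<comment> \<open>so that \<open>\<bar>v\<bar> powr p\<close> is differentiable and strictly convex\<close>
  have p: "1 < p"
  proof -
    have "s * p < 1 * p" using assms by (intro mult_strict_right_mono) auto
    then show ?thesis using assms(7) by linarith
  qed
  have eq_class: "mollified_points (\<lambda>i. a + of_int i) T (4 * \<epsilon>) \<rho> \<epsilon>" for a
    using assms by (intro mollified_points.intro periodic_points_equispaced mollified_points_axioms.intro) auto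
  interpret E: mollified_points "\<lambda>i. 0 + of_int i" T "4 * \<epsilon>" \<rho> \<epsilon> by (rule eq_class)
  have rangeE: "range (\<lambda>i. 0 + of_int i) = (\<int> :: real set)" by (auto simp: Ints_def)
  let ?w = "\<lambda>h. ennreal (1 / \<bar>h\<bar> powr (1 + s * p))"
  have nearest: "\<bar>h - of_int (round h)\<bar> \<le> 1/2" for h :: real
    using of_int_round_abs_le[of h] by (simp add: abs_minus_commute)
  \<comment> \<open>Kept general in \<open>m\<close>: the comparison uses \<open>round h\<close>,
    the strict case m = 1.\<close>
  have E_slice: "E.slice p h = real T * (\<bar>h - of_int m\<bar> powr p + E.bump (excess p (h - of_int m)) (h - of_int m))"
    if "\<bar>h - of_int m\<bar> \<le> 1/2" for h m
    by (rule E.slice_equispaced[OF p refl assms(3) that])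
  have E_energy: "energy \<rho> \<epsilon> s p T \<int> = (\<integral>\<^sup>+ h. ennreal (E.slice p h) * ?w h \<partial>lborel)"
    using E.energy_eq_slices[of p s] p unfolding rangeE by simp
  have E_finite: "energy \<rho> \<epsilon> s p T \<int> < \<infinity>"
    using E.equispaced_energy_finite[OF p assms(6,7) refl assms(3)] unfolding rangeE .
  have translate: "energy \<rho> \<epsilon> s p T ((\<lambda>x. x + a) ` \<int>) = energy \<rho> \<epsilon> s p T \<int>" for a
  proof -
    interpret A: mollified_points "\<lambda>i. a + of_int i" T "4 * \<epsilon>" \<rho> \<epsilon> by (rule eq_class)
    \<comment> \<open>The closed formula for an equispaced slice does not involve the offset
      \<open>a\<close>.\<close>
    have "A.slice p h = E.slice p h" for h
      using A.slice_equispaced[OF p refl assms(3) nearest] E_slice[OF nearest] by simp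
    then show ?thesis
      using A.energy_eq_slices[of p s] p unfolding E_energy range_equispaced by simp
  qed
  obtain z where z: "periodic_points z T (4 * \<epsilon>)" "X = range z"
    using config_class_obtain_points[OF X] assms by auto
  interpret Z: mollified_points z T "4 * \<epsilon>" \<rho> \<epsilon>
    using assms z(1) by (intro mollified_points.intro mollified_points_axioms.intro) auto
  have Z_energy: "energy \<rho> \<epsilon> s p T X = (\<integral>\<^sup>+ h. ennreal (Z.slice p h) * ?w h \<partial>lborel)"
    using Z.energy_eq_slices[of p s] p z(2) by simp
  have le: "E.slice p h \<le> Z.slice p h" for h
    using Z.slice_lower_bound[OF p] E_slice[OF nearest] by metis
  then have le': "ennreal (E.slice p h) * ?w h \<le> ennreal (Z.slice p h) * ?w h" for h
    by (intro mult_right_mono ennreal_leI) auto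
  then show "energy \<rho> \<epsilon> s p T \<int> \<le> energy \<rho> \<epsilon> s p T X"
    unfolding Z_energy E_energy by (intro nn_integral_mono)
  show "energy \<rho> \<epsilon> s p T X = energy \<rho> \<epsilon> s p T \<int> \<longleftrightarrow> (\<exists>a. X = (\<lambda>x. x + a) ` \<int>)"
  proof
    assume eq: "energy \<rho> \<epsilon> s p T X = energy \<rho> \<epsilon> s p T \<int>"
    show "\<exists>a. X = (\<lambda>x. x + a) ` \<int>"
    proof (cases rule: Z.equispaced_or_large_gap)
      case 1
      then have "X = range (\<lambda>i. z 0 + of_int i)" unfolding z(2) by metis
      then show ?thesis using range_equispaced by metis
    next
      case (2 j)
      \<comment> \<open>The bound 3/2 keeps 1 an integer nearest to h; the gap keeps the length of
        cell \<open>j\<close> negative.\<close>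
      define b where "b = min (3/2) (z (j + 1) - z j)"
      have b: "1 < b" using 2 by (simp add: b_def)
      have strict: "ennreal (E.slice p h) * ?w h < ennreal (Z.slice p h) * ?w h" if h: "h \<in> {1<..<b}" for h
      proof -
        have "E.slice p h < Z.slice p h"
          using E_slice[of h 1] Z.slice_lower_bound_strict[OF p 2(1), of h] h by (simp add: b_def)
        moreover have "0 < 1 / \<bar>h\<bar> powr (1 + s * p)" using h by simp
        ultimately show ?thesis
          using E.slice_nonneg[of p h] p by (intro ennreal_mult_strict_right_mono ennreal_lessI) auto
      qed
      have p0: "0 < p" using p by simp
      note [measurable] = E.slice_measurable[OF p0] Z.slice_measurable[OF p0]
      have meas: "(\<lambda>h. ennreal (E.slice p h) * ?w h) \<in> borel_measurable lborel"
        "(\<lambda>h. ennreal (Z.slice p h) * ?w h) \<in> borel_measurable lborel"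
        by measurable
      \<comment> \<open>The strict inequality holds on a whole interval, which is not a null
        set.\<close>
      have not_AE: "\<not> (AE h in lborel. ennreal (Z.slice p h) * ?w h \<le> ennreal (E.slice p h) * ?w h)"
      proof
        assume "AE h in lborel. ennreal (Z.slice p h) * ?w h \<le> ennreal (E.slice p h) * ?w h"
        then have "AE h in lborel. h \<notin> {1<..<b}"
          by eventually_elim (use strict in \<open>auto simp: not_less[symmetric]\<close>)
        then have "emeasure lborel {1<..<b} = 0"
          by (subst (asm) AE_iff_measurable[of "{1<..<b}"]) auto
        then show False using b by simp
      qed
      have "energy \<rho> \<epsilon> s p T \<int> < energy \<rho> \<epsilon> s p T X"
        unfolding E_energy Z_energy
        by (rule nn_integral_less[OF meas _ AE_I2[OF le'] not_AE])
           (use E_finite in \<open>auto simp: E_energy\<close>)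
      then show ?thesis using eq by simp
    qed
  next
    assume "\<exists>a. X = (\<lambda>x. x + a) ` \<int>"
    then show "energy \<rho> \<epsilon> s p T X = energy \<rho> \<epsilon> s p T \<int>" using translate by auto
  qed
qed

end
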